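(* Let $\phi : G \to H$ be an ordered functor of ordered groupoids. Then $\phi$ admits a factorization $$G \xrightarrow{\ i_\phi\ } M^{\phi} \xrightarrow{\ \varpi\ } M^{\phi}/\!/\ker p_\phi \longrightarrow H$$ as an enlargement ($i_\phi$), followed by a strong fibration (the quotient map $\varpi: m\mapsto[m]$), followed by a covering (the functor $[m]\mapsto mp_\phi$ induced by $p_\phi$).
   Context: Conventions: a groupoid $G$ is a small category in which every morphism is invertible, identified with its set of arrows under partial composition; $G_0\subseteq G$ is its set of identities. An arrow $g$ has domain $g\mathbf{d}=gg^{-1}$ and range $g\mathbf{r}=g^{-1}g$, and $gh$ is defined iff $g\mathbf{r}=h\mathbf{d}$. Maps are written on the right and composed from left to right. $\mathrm{star}_G(e)=\{g:g\mathbf{d}=e\}$ for $e\in G_0$. $\ker\phi=\{g\in G:g\phi\in H_0\}$. An ordered groupoid is a groupoid $G$ with a partial order $\leq$ on arrows such that: (OG1) $g\leq h$ implies $g^{-1}\leq h^{-1}$; (OG2) if $g_1\leq g_2$, $h_1\leq h_2$ and $g_1h_1$, $g_2h_2$ are defined, then $g_1h_1\leq g_2h_2$; (OG3) if $g\in G$, $f\in G_0$ and $f\leq g\mathbf{d}$, there is a unique $(f|g)\leq g$ with domain $f$. If $f\in G_0$, $f\leq g\mathbf{r}$, put $(g|f)=(f|g^{-1})^{-1}$. Ordered functors are order-preserving functors. A covering is an ordered functor whose restriction to each star $\mathrm{star}_G(e)\to\mathrm{star}_H(e\phi)$ is bijective. Products are ordered componentwise. $\mathscr{I}$ is the groupoid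 with two identities $0,1$ and two non-identity arrows $\iota,\iota^{-1}$, $\iota\mathbf{d}=0$, $\iota\mathbf{r}=1$, with the trivial order. An ordered functor $p:G\to H$ is a strong fibration if it has the ordered homotopy lifting property: for every ordered groupoid $A$ and all ordered functors $f:A\to G$ and $F:A\times\mathscr{I}\to H$ with $fp=i_0F$, where $i_0:a\mapsto(a,0)$, there is an ordered functor $\widetilde{F}:A\times\mathscr{I}\to G$ with $i_0\widetilde{F}=f$ and $\widetilde{F}p=F$. An enlargement is an inclusion of a subgroupoid $A\hookrightarrow B$ of ordered groupoids such that $A_0$ is an order ideal in $B_0$; if $b\in B$ and $b\mathbf{d},b\mathbf{r}\in A$ then $b\in A$; and for every $e\in B_0$ there is $b\in B$ with $b\mathbf{d}=e$ and $b\mathbf{r}\in A_0$. An ordered embedding $i:U\to B$ is an enlargement when $Ui\hookrightarrow B$ is. The mapping cocylinder of $\phi$ is the ordered groupoid $M^\phi=\{\langle h_0,a,h_1\rangle : a\in G,\ h_0,h_1\in H,\ h_0^{-1}(a\phi)h_1\text{ exists}\}$, with object set $\{(e,h)\in G_0\times H: e\phi=h\mathbf{d}\}$ (object $(e,h)$ corresponding to the identity $\langle h,e,h\rangle$), $\langle h_0,a,h_1\rangle\mathbf{d}=(a\mathbf{d},h_0)$, $\langle h_0,a,h_1\rangle\mathbf{r}=(a\mathbf{r},h_1)$, composition $\langle h_0,a,h_1\rangle\langle k_0,b,k_1\rangle=\langle h_0,ab,k_1\rangle$ when $(a\mathbf{r},h_1)=(b\mathbf{d},k_0)$, and componentwise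 order. Further $i_\phi:G\to M^\phi$, $g\mapsto\langle(g\mathbf{d})\phi,g,(g\mathbf{r})\phi\rangle$, and $p_\phi:M^\phi\to H$, $\langle h_0,a,h_1\rangle\mapsto h_0^{-1}(a\phi)h_1$. Quotient: for $A=\ker p_\phi$ in $M=M^\phi$, define $g\simeq_A h$ iff there are $a,b,c,d\in A$ with $agb\leq h$ and $chd\leq g$; this is an equivalence relation with classes $[g]$, and $M/\!/A$ is the set of classes, ordered by $[g]\leq[k]$ iff $agb\leq k$ for some $a,b\in A$. For $e,f\in M_0$ an $A$-nexus between $e$ and $f$ is a pair $(a,p)$ in $A$ with $aa^{-1}\leq e$, $a^{-1}a=f$, $pp^{-1}\leq f$, $p^{-1}p=e$. $[g][h]$ is defined iff $g^{-1}g\simeq_A hh^{-1}$, and then $[g][h]=[(g|aa^{-1})ah]$ for any $A$-nexus $(a,p)$ between $g^{-1}g$ and $hh^{-1}$. This makes $M/\!/A$ an ordered groupoid. *)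

theory Defs
  imports Main
begin

text \<open>
  Maps are written on the left here, so \<open>g\<^bold>d\<close> becomes \<open>Dom G g\<close> and \<open>g\<phi>\<close> becomes \<open>\<phi> g\<close>.
  The composition \<open>g \<cdot> h\<close> of arrows keeps the diagrammatic order: it is meaningful iff
  \<open>Rng G g = Dom G h\<close>. Composition and order are total HOL functions whose values outside
  the arrow set are irrelevant.
\<close>

section \<open>Groupoids and ordered groupoids\<close>

record 'a gpd =
  Arr :: "'a set"
  Dom :: "'a \<Rightarrow> 'a"
  Rng :: "'a \<Rightarrow> 'a"
  Comp :: "'a \<Rightarrow> 'a \<Rightarrow> 'a"  (infixl "\<cdot>\<index>" 70)

record 'a ogpd = "'a gpd" +
  Le :: "'a \<Rightarrow> 'a \<Rightarrow> bool"  (infix "\<preceq>\<index>" 50)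

locale groupoid =
  fixes G :: "('a, 'm) gpd_scheme" (structure)
  assumes Dom_closed: "g \<in> Arr G \<Longrightarrow> Dom G g \<in> Arr G"
    and Rng_closed: "g \<in> Arr G \<Longrightarrow> Rng G g \<in> Arr G"
    and Dom_Dom: "g \<in> Arr G \<Longrightarrow> Dom G (Dom G g) = Dom G g"
    and Rng_Dom: "g \<in> Arr G \<Longrightarrow> Rng G (Dom G g) = Dom G g"
    and Dom_Rng: "g \<in> Arr G \<Longrightarrow> Dom G (Rng G g) = Rng G g"
    and Rng_Rng: "g \<in> Arr G \<Longrightarrow> Rng G (Rng G g) = Rng G g"
    and Comp_closed: "\<lbrakk>g \<in> Arr G; h \<in> Arr G; Rng G g = Dom G h\<rbrakk> \<Longrightarrow> g \<cdot> h \<in> Arr G"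
    and Dom_Comp: "\<lbrakk>g \<in> Arr G; h \<in> Arr G; Rng G g = Dom G h\<rbrakk> \<Longrightarrow> Dom G (g \<cdot> h) = Dom G g"
    and Rng_Comp: "\<lbrakk>g \<in> Arr G; h \<in> Arr G; Rng G g = Dom G h\<rbrakk> \<Longrightarrow> Rng G (g \<cdot> h) = Rng G h"
    and Comp_Dom: "g \<in> Arr G \<Longrightarrow> Dom G g \<cdot> g = g"
    and Comp_Rng: "g \<in> Arr G \<Longrightarrow> g \<cdot> Rng G g = g"
    and Comp_assoc: "\<lbrakk>g \<in> Arr G; h \<in> Arr G; k \<in> Arr G; Rng G g = Dom G h; Rng G h = Dom G k\<rbrakk>
      \<Longrightarrow> (g \<cdot> h) \<cdot> k = g \<cdot> (h \<cdot> k)"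
    and invertible: "g \<in> Arr G \<Longrightarrow>
      \<exists>h \<in> Arr G. Dom G h = Rng G g \<and> Rng G h = Dom G g \<and> g \<cdot> h = Dom G g \<and> h \<cdot> g = Rng G g"

definition Inv :: "('a, 'm) gpd_scheme \<Rightarrow> 'a \<Rightarrow> 'a" where
  "Inv G g = (THE h. h \<in> Arr G \<and> Dom G h = Rng G g \<and> Rng G h = Dom G g \<and>
                g \<cdot>\<^bsub>G\<^esub> h = Dom G g \<and> h \<cdot>\<^bsub>G\<^esub> g = Rng G g)"

definition Ids :: "('a, 'm) gpd_scheme \<Rightarrow> 'a set" where
  "Ids G = {e \<in> Arr G. Dom G e = e}"

definition Star :: "('a, 'm) gpd_scheme \<Rightarrow> 'a \<Rightarrow> 'a set" where
  "Star G e = {g \<in> Arr G. Dom G g = e}"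

locale ordered_groupoid = groupoid G
  for G :: "('a, 'm) ogpd_scheme" (structure) +
  assumes Le_refl: "reflp_on (Arr G) (Le G)"
    and Le_antisym: "antisymp_on (Arr G) (Le G)"
    and Le_trans: "transp_on (Arr G) (Le G)"
    and OG1: "\<lbrakk>g \<in> Arr G; h \<in> Arr G; g \<preceq> h\<rbrakk> \<Longrightarrow> Inv G g \<preceq> Inv G h"
    and OG2: "\<lbrakk>g1 \<in> Arr G; g2 \<in> Arr G; h1 \<in> Arr G; h2 \<in> Arr G; g1 \<preceq> g2; h1 \<preceq> h2;
        Rng G g1 = Dom G h1; Rng G g2 = Dom G h2\<rbrakk> \<Longrightarrow> g1 \<cdot> h1 \<preceq> g2 \<cdot> h2"
    and OG3: "\<lbrakk>g \<in> Arr G; f \<in> Ids G; f \<preceq> Dom G g\<rbrakk>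
        \<Longrightarrow> \<exists>!x. x \<in> Arr G \<and> x \<preceq> g \<and> Dom G x = f"

text \<open>The restriction \<open>(f|g)\<close> and the corestriction \<open>(g|f)\<close>.\<close>

definition restr :: "('a, 'm) ogpd_scheme \<Rightarrow> 'a \<Rightarrow> 'a \<Rightarrow> 'a" where
  "restr G f g = (THE x. x \<in> Arr G \<and> x \<preceq>\<^bsub>G\<^esub> g \<and> Dom G x = f)"

definition corestr :: "('a, 'm) ogpd_scheme \<Rightarrow> 'a \<Rightarrow> 'a \<Rightarrow> 'a" where
  "corestr G g f = Inv G (restr G f (Inv G g))"


section \<open>Ordered functors, kernels, coverings\<close>

locale ordered_functor = G: ordered_groupoid G + H: ordered_groupoid H
  for G :: "('a, 'm) ogpd_scheme" and H :: "('b, 'n) ogpd_scheme" +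
  fixes \<phi> :: "'a \<Rightarrow> 'b"
  assumes map_closed: "g \<in> Arr G \<Longrightarrow> \<phi> g \<in> Arr H"
    and map_Dom: "g \<in> Arr G \<Longrightarrow> \<phi> (Dom G g) = Dom H (\<phi> g)"
    and map_Rng: "g \<in> Arr G \<Longrightarrow> \<phi> (Rng G g) = Rng H (\<phi> g)"
    and map_Comp: "\<lbrakk>g \<in> Arr G; h \<in> Arr G; Rng G g = Dom G h\<rbrakk>
        \<Longrightarrow> \<phi> (g \<cdot>\<^bsub>G\<^esub> h) = \<phi> g \<cdot>\<^bsub>H\<^esub> \<phi> h"
    and map_mono: "monotone_on (Arr G) (Le G) (Le H) \<phi>"

definition Ker :: "('a, 'm) gpd_scheme \<Rightarrow> ('b, 'n) gpd_scheme \<Rightarrow> ('a \<Rightarrow> 'b) \<Rightarrow> 'a set" where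
  "Ker G H \<phi> = {g \<in> Arr G. \<phi> g \<in> Ids H}"

definition covering ::
    "('a, 'm) ogpd_scheme \<Rightarrow> ('b, 'n) ogpd_scheme \<Rightarrow> ('a \<Rightarrow> 'b) \<Rightarrow> bool" where
  "covering G H \<phi> \<longleftrightarrow>
     ordered_functor G H \<phi> \<and> (\<forall>e \<in> Ids G. bij_betw \<phi> (Star G e) (Star H (\<phi> e)))"


section \<open>Enlargements\<close>

text \<open>
  The subgroupoid is given by its set \<open>U\<close> of arrows, with the operations and the order induced
  from \<open>B\<close>; closure of \<open>U\<close> under the operations is part of \<open>B\<lparr>Arr := U\<rparr>\<close> being a groupoid.
\<close>

definition enlargement :: "('b, 'n) ogpd_scheme \<Rightarrow> 'b set \<Rightarrow> bool" where
  "enlargement B U \<longleftrightarrow>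
     ordered_groupoid B \<and> U \<subseteq> Arr B \<and> ordered_groupoid (B\<lparr>Arr := U\<rparr>) \<and>
     (\<forall>f \<in> Ids B. \<forall>e \<in> Ids B. f \<preceq>\<^bsub>B\<^esub> e \<and> e \<in> U \<longrightarrow> f \<in> U) \<and>
     (\<forall>b \<in> Arr B. Dom B b \<in> U \<and> Rng B b \<in> U \<longrightarrow> b \<in> U) \<and>
     (\<forall>e \<in> Ids B. \<exists>b \<in> Arr B. Dom B b = e \<and> Rng B b \<in> U)"

definition ordered_embedding ::
    "('a, 'm) ogpd_scheme \<Rightarrow> ('b, 'n) ogpd_scheme \<Rightarrow> ('a \<Rightarrow> 'b) \<Rightarrow> bool" where
  "ordered_embedding U B i \<longleftrightarrow>
     ordered_functor U B i \<and> inj_on i (Arr U) \<and>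
     (\<forall>g \<in> Arr U. \<forall>h \<in> Arr U. i g \<preceq>\<^bsub>B\<^esub> i h \<longrightarrow> g \<preceq>\<^bsub>U\<^esub> h)"

definition enlargement_map ::
    "('a, 'm) ogpd_scheme \<Rightarrow> ('b, 'n) ogpd_scheme \<Rightarrow> ('a \<Rightarrow> 'b) \<Rightarrow> bool" where
  "enlargement_map U B i \<longleftrightarrow> ordered_embedding U B i \<and> enlargement B (i ` Arr U)"


section \<open>The interval, products and strong fibrations\<close>

datatype interval_arr = I0 | I1 | Iota | Iota_inv

fun interval_dom :: "interval_arr \<Rightarrow> interval_arr" where
  "interval_dom I0 = I0"
| "interval_dom I1 = I1"
| "interval_dom Iota = I0"
| "interval_dom Iota_inv = I1"

fun interval_rng :: "interval_arr \<Rightarrow> interval_arr" where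
  "interval_rng I0 = I0"
| "interval_rng I1 = I1"
| "interval_rng Iota = I1"
| "interval_rng Iota_inv = I0"

text \<open>The last equation covers \<open>\<iota> \<cdot> 1\<close> and \<open>\<iota>\<inverse> \<cdot> 0\<close>; its other instances are not composable.\<close>

fun interval_comp :: "interval_arr \<Rightarrow> interval_arr \<Rightarrow> interval_arr" where
  "interval_comp I0 x = x"
| "interval_comp I1 x = x"
| "interval_comp Iota Iota_inv = I0"
| "interval_comp Iota_inv Iota = I1"
| "interval_comp x _ = x"

definition interval :: "interval_arr ogpd" where
  "interval = \<lparr>Arr = UNIV, Dom = interval_dom, Rng = interval_rng, Comp = interval_comp,
               Le = (=)\<rparr>"

definition prod_ogpd ::
    "('a, 'm) ogpd_scheme \<Rightarrow> ('b, 'n) ogpd_scheme \<Rightarrow> ('a \<times> 'b) ogpd" where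
  "prod_ogpd G H =
     \<lparr>Arr = Arr G \<times> Arr H,
      Dom = (\<lambda>(g, h). (Dom G g, Dom H h)),
      Rng = (\<lambda>(g, h). (Rng G g, Rng H h)),
      Comp = (\<lambda>(g, h) (g', h'). (g \<cdot>\<^bsub>G\<^esub> g', h \<cdot>\<^bsub>H\<^esub> h')),
      Le = (\<lambda>(g, h) (g', h'). g \<preceq>\<^bsub>G\<^esub> g' \<and> h \<preceq>\<^bsub>H\<^esub> h')\<rparr>"

text \<open>
  The lifting property quantifies over all ordered groupoids \<open>A\<close>. Since HOL cannot quantify over
  types inside a formula, the arrow type \<open>'c\<close> of \<open>A\<close> is a parameter; a theorem that concludes
  \<open>strong_fibration TYPE('c) G H p\<close> for a type variable \<open>'c\<close> occurring nowhere else asserts the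
  property for ordered groupoids \<open>A\<close> over every type.
\<close>

definition strong_fibration ::
    "'c itself \<Rightarrow> ('a, 'm) ogpd_scheme \<Rightarrow> ('b, 'n) ogpd_scheme \<Rightarrow> ('a \<Rightarrow> 'b) \<Rightarrow> bool" where
  "strong_fibration _ G H p \<longleftrightarrow>
     ordered_functor G H p \<and>
     (\<forall>(A :: 'c ogpd) f F.
        ordered_groupoid A \<longrightarrow> ordered_functor A G f \<longrightarrow>
        ordered_functor (prod_ogpd A interval) H F \<longrightarrow>
        (\<forall>a \<in> Arr A. p (f a) = F (a, I0)) \<longrightarrow>
        (\<exists>F'. ordered_functor (prod_ogpd A interval) G F' \<and>
           (\<forall>a \<in> Arr A. F' (a, I0) = f a) \<and>
           (\<forall>x \<in> Arr (prod_ogpd A interval). p (F' x) = F x)))"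


section \<open>The mapping cocylinder\<close>

text \<open>
  The triple \<open>\<langle>h\<^sub>0, a, h\<^sub>1\<rangle>\<close> is encoded as a tuple, and the object \<open>(e, h)\<close> as the identity arrow
  \<open>\<langle>h, e, h\<rangle>\<close>.
\<close>

definition cocylinder ::
    "('a, 'm) ogpd_scheme \<Rightarrow> ('b, 'n) ogpd_scheme \<Rightarrow> ('a \<Rightarrow> 'b) \<Rightarrow> ('b \<times> 'a \<times> 'b) ogpd" where
  "cocylinder G H \<phi> =
     \<lparr>Arr = {(h0, a, h1). h0 \<in> Arr H \<and> a \<in> Arr G \<and> h1 \<in> Arr H \<and>
               Rng H (Inv H h0) = Dom H (\<phi> a) \<and> Rng H (\<phi> a) = Dom H h1},
      Dom = (\<lambda>(h0, a, h1). (h0, Dom G a, h0)),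
      Rng = (\<lambda>(h0, a, h1). (h1, Rng G a, h1)),
      Comp = (\<lambda>(h0, a, h1) (k0, b, k1). (h0, a \<cdot>\<^bsub>G\<^esub> b, k1)),
      Le = (\<lambda>(h0, a, h1) (k0, b, k1). h0 \<preceq>\<^bsub>H\<^esub> k0 \<and> a \<preceq>\<^bsub>G\<^esub> b \<and> h1 \<preceq>\<^bsub>H\<^esub> k1)\<rparr>"

definition cocyl_in :: "('a, 'm) ogpd_scheme \<Rightarrow> ('a \<Rightarrow> 'b) \<Rightarrow> 'a \<Rightarrow> 'b \<times> 'a \<times> 'b" where
  "cocyl_in G \<phi> g = (\<phi> (Dom G g), g, \<phi> (Rng G g))"

definition cocyl_proj :: "('b, 'n) ogpd_scheme \<Rightarrow> ('a \<Rightarrow> 'b) \<Rightarrow> 'b \<times> 'a \<times> 'b \<Rightarrow> 'b" where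
  "cocyl_proj H \<phi> = (\<lambda>(h0, a, h1). (Inv H h0 \<cdot>\<^bsub>H\<^esub> \<phi> a) \<cdot>\<^bsub>H\<^esub> h1)"


section \<open>The quotient\<close>

text \<open>\<open>agb \<preceq> h\<close> for some \<open>a, b \<in> A\<close>, where the composite is required to exist.\<close>

definition qle :: "('a, 'm) ogpd_scheme \<Rightarrow> 'a set \<Rightarrow> 'a \<Rightarrow> 'a \<Rightarrow> bool" where
  "qle M A g h \<longleftrightarrow>
     (\<exists>a \<in> A. \<exists>b \<in> A. Rng M a = Dom M g \<and> Rng M g = Dom M b \<and> (a \<cdot>\<^bsub>M\<^esub> g) \<cdot>\<^bsub>M\<^esub> b \<preceq>\<^bsub>M\<^esub> h)"

definition qrel :: "('a, 'm) ogpd_scheme \<Rightarrow> 'a set \<Rightarrow> ('a \<times> 'a) set" where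
  "qrel M A = {(g, h). g \<in> Arr M \<and> h \<in> Arr M \<and> qle M A g h \<and> qle M A h g}"

definition qclass :: "('a, 'm) ogpd_scheme \<Rightarrow> 'a set \<Rightarrow> 'a \<Rightarrow> 'a set" where
  "qclass M A g = qrel M A `` {g}"

definition nexus :: "('a, 'm) ogpd_scheme \<Rightarrow> 'a set \<Rightarrow> 'a \<Rightarrow> 'a \<Rightarrow> 'a \<Rightarrow> 'a \<Rightarrow> bool" where
  "nexus M A e f a p \<longleftrightarrow> a \<in> A \<and> p \<in> A \<and>
     Dom M a \<preceq>\<^bsub>M\<^esub> e \<and> Rng M a = f \<and> Dom M p \<preceq>\<^bsub>M\<^esub> f \<and> Rng M p = e"

text \<open>
  Operations on classes are given by representatives. The domain and range of \<open>[g]\<close> are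
  \<open>[gg\<inverse>]\<close> and \<open>[g\<inverse>g]\<close>, which is what makes \<open>[g][h]\<close> defined iff \<open>g\<inverse>g\<close> and \<open>hh\<inverse>\<close> are
  equivalent. Each \<open>the_elem\<close> is meaningful only if the set of values over all choices is a
  singleton, so independence of the choices is not built in but has to be proved.
\<close>

definition quot :: "('a, 'm) ogpd_scheme \<Rightarrow> 'a set \<Rightarrow> 'a set ogpd" where
  "quot M A =
     \<lparr>Arr = Arr M // qrel M A,
      Dom = (\<lambda>X. the_elem ((\<lambda>g. qclass M A (Dom M g)) ` X)),
      Rng = (\<lambda>X. the_elem ((\<lambda>g. qclass M A (Rng M g)) ` X)),
      Comp = (\<lambda>X Y. the_elem
        {qclass M A ((corestr M g (Dom M a) \<cdot>\<^bsub>M\<^esub> a) \<cdot>\<^bsub>M\<^esub> h) | g h a p.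
           g \<in> X \<and> h \<in> Y \<and> nexus M A (Rng M g) (Dom M h) a p}),
      Le = (\<lambda>X Y. \<exists>g \<in> X. \<exists>k \<in> Y. qle M A g k)\<rparr>"

definition induced :: "('a \<Rightarrow> 'b) \<Rightarrow> 'a set \<Rightarrow> 'b" where
  "induced p X = the_elem (p ` X)"

end

theory Submission
  imports Defs
begin

text \<open>
  The argument rests on one observation about the kernel \<open>K\<close> of an arbitrary ordered functor \<open>p\<close>.
  Say that an identity \<open>e\<close> is dominated by \<open>f\<close>, \<open>e \<unlhd> f\<close>, if an arrow of \<open>K\<close> runs into \<open>e\<close> from an
  identity below \<open>f\<close>. Then \<open>agb \<le> h\<close> for some \<open>a, b \<in> K\<close>, the relation that defines the quotient,
  holds exactly when the domain of \<open>g\<close> is dominated by that of \<open>h\<close> and \<open>p g \<le> p h\<close> (lemma \<open>qle_iff\<close>):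
  once \<open>a\<close> has been chosen, \<open>b\<close> is forced, and its image is an identity because restrictions in the
  target are unique. A class \<open>[g]\<close> is therefore determined by the class of the domain of \<open>g\<close> together
  with the image \<open>p g\<close>. The composite of two classes computed through any nexus has the domain class
  of the first factor and the product of the two images (\<open>nexus_composite\<close>), so it does not depend
  on the choices, and all laws of an ordered groupoid for \<open>M//K\<close> are inherited from domination of
  identities and from the laws of the target. The induced functor is injective on stars for the same
  reason, and it is a covering as soon as \<open>p\<close> is surjective on stars (\<open>covering_induced\<close>).

  The projection \<open>p\<^sub>\<phi>\<close> of the cocylinder is surjective on stars, because from the object \<open>(e, h)\<close> one
  can move along \<open>\<langle>h, e, hk\<rangle>\<close>, an arrow with image \<open>k\<close>. This lift is an explicit expression in the
  data, monotone in all of them. Hence a homotopy in \<open>H\<close> that starts at the projection of \<open>f\<close> is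
  lifted by multiplying the two outer components of \<open>f\<close> by values of the homotopy, and \<open>p\<^sub>\<phi>\<close> is a
  strong fibration (\<open>strong_fibration_proj\<close>).

  Finally, the quotient map \<open>\<varpi>\<close> inherits the lifting property from \<open>p\<^sub>\<phi>\<close>: push a homotopy in the
  quotient down to \<open>H\<close> and lift it to \<open>M\<^sup>\<phi>\<close>. The image of this lift under \<open>\<varpi>\<close> and the given homotopy
  are two lifts, starting at the same place, of one homotopy along a covering, so they coincide
  (\<open>strong_fibration_of_covering_factor\<close>).

  For \<open>i\<^sub>\<phi>\<close>, the image is the full subgroupoid on the objects \<open>(e, \<phi> e)\<close>, and every object \<open>(e, h)\<close> is
  joined to one of these by an arrow over \<open>e\<close> (\<open>enlargement_map_incl\<close>).
\<close>

section \<open>Arrows of groupoids and of ordered groupoids\<close>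

context groupoid
begin

lemma Inv_props:
  assumes "g \<in> Arr G"
  shows Inv_closed: "Inv G g \<in> Arr G"
    and Dom_Inv: "Dom G (Inv G g) = Rng G g"
    and Rng_Inv: "Rng G (Inv G g) = Dom G g"
    and Comp_Inv_right: "g \<cdot> Inv G g = Dom G g"
    and Comp_Inv_left: "Inv G g \<cdot> g = Rng G g"
proof -
  let ?P = "\<lambda>h. h \<in> Arr G \<and> Dom G h = Rng G g \<and> Rng G h = Dom G g \<and> g \<cdot> h = Dom G g \<and> h \<cdot> g = Rng G g"
  obtain h where h: "?P h"
    using invertible[OF assms] by blast
  have "x = h" if "?P x" for x
    using that h assms Comp_assoc[of x g h] Comp_Rng[of x] Comp_Dom[of h] by simp
  with h have "?P (Inv G g)"
    unfolding Inv_def by (rule theI)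
  then show "Inv G g \<in> Arr G" "Dom G (Inv G g) = Rng G g" "Rng G (Inv G g) = Dom G g"
    "g \<cdot> Inv G g = Dom G g" "Inv G g \<cdot> g = Rng G g"
    by simp_all
qed

lemmas arrow_simps [simp] =
  Dom_closed Rng_closed Dom_Dom Rng_Dom Dom_Rng Rng_Rng Comp_closed Dom_Comp Rng_Comp
  Comp_Dom Comp_Rng Inv_closed Dom_Inv Rng_Inv Comp_Inv_right Comp_Inv_left

lemma Inv_Comp_cancel [simp]:
  "\<lbrakk>g \<in> Arr G; h \<in> Arr G; Rng G g = Dom G h\<rbrakk> \<Longrightarrow> Inv G g \<cdot> (g \<cdot> h) = h"
  using Comp_assoc[of "Inv G g" g h] by simp

lemma Comp_Inv_cancel [simp]:
  "\<lbrakk>g \<in> Arr G; h \<in> Arr G; Dom G g = Dom G h\<rbrakk> \<Longrightarrow> g \<cdot> (Inv G g \<cdot> h) = h"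
  using Comp_assoc[of g "Inv G g" h] by simp

lemma Inv_eqI:
  assumes "g \<in> Arr G" "h \<in> Arr G" "Rng G g = Dom G h" "g \<cdot> h = Dom G g"
  shows "Inv G g = h"
  using assms Inv_Comp_cancel[of g h] Comp_Rng[of "Inv G g"] by simp

lemma Inv_Inv [simp]: "g \<in> Arr G \<Longrightarrow> Inv G (Inv G g) = g"
  by (rule Inv_eqI) simp_all

lemma Inv_Comp [simp]:
  "\<lbrakk>g \<in> Arr G; h \<in> Arr G; Rng G g = Dom G h\<rbrakk> \<Longrightarrow> Inv G (g \<cdot> h) = Inv G h \<cdot> Inv G g"
  by (rule Inv_eqI) (simp_all add: Comp_assoc)

lemma Inv_Dom [simp]: "g \<in> Arr G \<Longrightarrow> Inv G (Dom G g) = Dom G g"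
  using Comp_Dom[of "Dom G g"] by (intro Inv_eqI) simp_all

lemma Dom_in_Ids [simp]: "g \<in> Arr G \<Longrightarrow> Dom G g \<in> Ids G"
  and Rng_in_Ids [simp]: "g \<in> Arr G \<Longrightarrow> Rng G g \<in> Ids G"
  by (simp_all add: Ids_def)

lemma IdsI: "\<lbrakk>Dom G e = e; e \<in> Arr G\<rbrakk> \<Longrightarrow> e \<in> Ids G"
  by (simp add: Ids_def)

lemma Ids_in_Arr [simp]: "e \<in> Ids G \<Longrightarrow> e \<in> Arr G"
  and Dom_Id [simp]: "e \<in> Ids G \<Longrightarrow> Dom G e = e"
  by (simp_all add: Ids_def)

lemma Rng_Id [simp]: "e \<in> Ids G \<Longrightarrow> Rng G e = e"
  using Rng_Dom[of e] by simp

lemma Inv_Id [simp]: "e \<in> Ids G \<Longrightarrow> Inv G e = e"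
  using Inv_Dom[of e] by simp

lemma Comp_Id [simp]: "\<lbrakk>e \<in> Ids G; g \<in> Arr G; Rng G g = e\<rbrakk> \<Longrightarrow> g \<cdot> e = g"
  by auto

end

context ordered_groupoid
begin

lemma Le_reflI [simp]: "g \<in> Arr G \<Longrightarrow> g \<preceq> g"
  using Le_refl by (simp add: reflp_on_def)

lemma Le_transE: "\<lbrakk>g \<preceq> h; h \<preceq> k; g \<in> Arr G; h \<in> Arr G; k \<in> Arr G\<rbrakk> \<Longrightarrow> g \<preceq> k"
  using Le_trans unfolding transp_on_def by blast

lemma Le_antisymE: "\<lbrakk>g \<preceq> h; h \<preceq> g; g \<in> Arr G; h \<in> Arr G\<rbrakk> \<Longrightarrow> g = h"
  using Le_antisym unfolding antisymp_on_def by blast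

lemma Dom_mono: "\<lbrakk>g \<preceq> h; g \<in> Arr G; h \<in> Arr G\<rbrakk> \<Longrightarrow> Dom G g \<preceq> Dom G h"
  using OG1[of g h] OG2[of g h "Inv G g" "Inv G h"] by simp

lemma Rng_mono: "\<lbrakk>g \<preceq> h; g \<in> Arr G; h \<in> Arr G\<rbrakk> \<Longrightarrow> Rng G g \<preceq> Rng G h"
  using Dom_mono[of "Inv G g" "Inv G h"] OG1[of g h] by simp

lemma Le_unique_Dom:
  "\<lbrakk>x \<preceq> g; y \<preceq> g; Dom G x = Dom G y; x \<in> Arr G; y \<in> Arr G; g \<in> Arr G\<rbrakk> \<Longrightarrow> x = y"
  using OG3[of g "Dom G x"] Dom_mono[of x g] by auto

lemma Le_unique_Rng:
  assumes "x \<preceq> g" "y \<preceq> g" "Rng G x = Rng G y" "x \<in> Arr G" "y \<in> Arr G" "g \<in> Arr G"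
  shows "x = y"
proof -
  have "Inv G x = Inv G y"
    using assms by (intro Le_unique_Dom[of "Inv G x" "Inv G g" "Inv G y"] OG1) simp_all
  then show ?thesis
    using assms by (metis Inv_Inv)
qed

text \<open>Both \<open>g\<close> and its domain are restrictions of \<open>e\<close> to the domain of \<open>g\<close>, and restrictions are
  unique.\<close>

lemma Le_Id_imp_Id:
  assumes "g \<preceq> e" "e \<in> Ids G" "g \<in> Arr G"
  shows "g \<in> Ids G"
proof -
  have "Dom G g = g"
    using assms Dom_mono[of g e] by (intro Le_unique_Dom[of "Dom G g" e g]) simp_all
  then show ?thesis
    using assms by (intro IdsI)
qed

lemma restr_props:
  assumes "g \<in> Arr G" "f \<in> Ids G" "f \<preceq> Dom G g"
  shows restr_closed: "restr G f g \<in> Arr G"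
    and restr_Le: "restr G f g \<preceq> g"
    and Dom_restr: "Dom G (restr G f g) = f"
  using theI'[OF OG3[OF assms]] unfolding restr_def by auto

lemma corestr_props:
  assumes "g \<in> Arr G" "f \<in> Ids G" "f \<preceq> Rng G g"
  shows corestr_closed: "corestr G g f \<in> Arr G"
    and corestr_Le: "corestr G g f \<preceq> g"
    and Rng_corestr: "Rng G (corestr G g f) = f"
proof -
  have "restr G f (Inv G g) \<in> Arr G" "restr G f (Inv G g) \<preceq> Inv G g"
    "Dom G (restr G f (Inv G g)) = f"
    using assms restr_props[of "Inv G g" f] by simp_all
  then show "corestr G g f \<in> Arr G" "corestr G g f \<preceq> g" "Rng G (corestr G g f) = f"
    using assms OG1[of "restr G f (Inv G g)" "Inv G g"] unfolding corestr_def by simp_all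
qed

end

context ordered_functor
begin

lemmas map_simps [simp] = map_closed map_Dom map_Rng map_Comp

lemma map_Le: "\<lbrakk>g \<preceq>\<^bsub>G\<^esub> h; g \<in> Arr G; h \<in> Arr G\<rbrakk> \<Longrightarrow> \<phi> g \<preceq>\<^bsub>H\<^esub> \<phi> h"
  using map_mono unfolding monotone_on_def by blast

lemma map_composable:
  "\<lbrakk>Rng G g = Dom G h; g \<in> Arr G; h \<in> Arr G\<rbrakk> \<Longrightarrow> Rng H (\<phi> g) = Dom H (\<phi> h)"
  by (metis map_Dom map_Rng)

lemma map_Inv [simp]: "g \<in> Arr G \<Longrightarrow> \<phi> (Inv G g) = Inv H (\<phi> g)"
  using map_Comp[of g "Inv G g"] map_composable[of g "Inv G g"]
  by (intro H.Inv_eqI[symmetric]) simp_all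

lemma map_Ids [simp]: "e \<in> Ids G \<Longrightarrow> \<phi> e \<in> Ids H"
  using map_Dom[of e] by (intro H.IdsI) simp_all


section \<open>The quotient by a kernel\<close>

abbreviation K :: "'a set" where
  "K \<equiv> Ker G H \<phi>"

abbreviation Q :: "'a set ogpd" where
  "Q \<equiv> quot G K"

abbreviation cls :: "'a \<Rightarrow> 'a set" where
  "cls \<equiv> qclass G K"

definition dominated :: "'a \<Rightarrow> 'a \<Rightarrow> bool"  (infix "\<unlhd>" 50) where
  "e \<unlhd> f \<longleftrightarrow> (\<exists>a \<in> K. Rng G a = e \<and> Dom G a \<preceq>\<^bsub>G\<^esub> f)"

lemma KerI: "\<lbrakk>\<phi> a \<in> Ids H; a \<in> Arr G\<rbrakk> \<Longrightarrow> a \<in> K"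
  by (simp add: Ker_def)

lemma Ker_in_Arr [simp]: "a \<in> K \<Longrightarrow> a \<in> Arr G"
  and Ker_map: "a \<in> K \<Longrightarrow> \<phi> a \<in> Ids H"
  by (simp_all add: Ker_def)

lemma Ker_map_Dom: "a \<in> K \<Longrightarrow> Dom H (\<phi> a) = \<phi> a"
  and Ker_map_Rng: "a \<in> K \<Longrightarrow> Rng H (\<phi> a) = \<phi> a"
  using Ker_map by simp_all

lemma Ker_Inv [simp]: "a \<in> K \<Longrightarrow> Inv G a \<in> K"
  by (intro KerI) (simp_all add: Ker_map)

lemma Ker_Comp [simp]:
  assumes "a \<in> K" "b \<in> K" "Rng G a = Dom G b"
  shows "a \<cdot>\<^bsub>G\<^esub> b \<in> K"
proof (rule KerI)
  have "\<phi> (a \<cdot>\<^bsub>G\<^esub> b) = \<phi> b"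
    using assms map_composable[OF assms(3)] Ker_map by simp
  then show "\<phi> (a \<cdot>\<^bsub>G\<^esub> b) \<in> Ids H"
    using assms Ker_map by simp
qed (use assms in simp)

lemma Ids_in_Ker [simp]: "e \<in> Ids G \<Longrightarrow> e \<in> K"
  by (intro KerI) simp_all

lemma Ker_down: "\<lbrakk>a \<preceq>\<^bsub>G\<^esub> b; b \<in> K; a \<in> Arr G\<rbrakk> \<Longrightarrow> a \<in> K"
  by (rule KerI, rule H.Le_Id_imp_Id[of "\<phi> a" "\<phi> b"]) (simp_all add: map_Le Ker_map)

lemma Le_imp_dominated: "\<lbrakk>e \<preceq>\<^bsub>G\<^esub> f; e \<in> Ids G\<rbrakk> \<Longrightarrow> e \<unlhd> f"
  unfolding dominated_def by (rule bexI[of _ e]) simp_all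

lemma dominated_refl [simp]: "e \<in> Ids G \<Longrightarrow> e \<unlhd> e"
  by (simp add: Le_imp_dominated)

lemma Ker_dominated:
  assumes "a \<in> K"
  shows "Dom G a \<unlhd> Rng G a" "Rng G a \<unlhd> Dom G a"
  unfolding dominated_def using assms
  by (auto intro: bexI[of _ "Inv G a"] bexI[of _ a])

text \<open>Given \<open>a\<close> from below \<open>f\<close> into \<open>e\<close> and \<open>b\<close> from below \<open>k\<close> into \<open>f\<close>, corestrict \<open>b\<close> to the domain
  of \<open>a\<close> and compose.\<close>

lemma dominated_trans:
  assumes "e \<unlhd> f" "f \<unlhd> k" "f \<in> Ids G" "k \<in> Ids G"
  shows "e \<unlhd> k"
proof -
  obtain a b where a: "a \<in> K" "Rng G a = e" "Dom G a \<preceq>\<^bsub>G\<^esub> f"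
    and b: "b \<in> K" "Rng G b = f" "Dom G b \<preceq>\<^bsub>G\<^esub> k"
    using assms unfolding dominated_def by blast
  define b' where "b' = corestr G b (Dom G a)"
  have b': "b' \<in> Arr G" "b' \<preceq>\<^bsub>G\<^esub> b" "Rng G b' = Dom G a"
    using a b G.corestr_props[of b "Dom G a"] by (simp_all add: b'_def)
  then have "b' \<in> K"
    using b Ker_down by blast
  moreover have "Dom G b' \<preceq>\<^bsub>G\<^esub> k"
    using b' b assms G.Dom_mono[of b' b] G.Le_transE[of "Dom G b'" "Dom G b" k] by simp
  ultimately show ?thesis
    unfolding dominated_def using a b' by (intro bexI[of _ "b' \<cdot>\<^bsub>G\<^esub> a"]) simp_all
qed

lemma dominated_map:
  assumes "e \<unlhd> f" "f \<in> Ids G"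
  shows "\<phi> e \<preceq>\<^bsub>H\<^esub> \<phi> f"
proof -
  obtain a where a: "a \<in> K" "Rng G a = e" "Dom G a \<preceq>\<^bsub>G\<^esub> f"
    using assms unfolding dominated_def by blast
  have "\<phi> e = \<phi> (Dom G a)"
    using a Ker_map_Dom[of a] Ker_map_Rng[of a] map_Dom[of a] map_Rng[of a] by simp
  then show ?thesis
    using a assms map_Le[of "Dom G a" f] by simp
qed

text \<open>The two-sided relation splits into a condition on domains and a condition on images. For the
  converse, restrict \<open>h\<close> to the domain of the dominating arrow \<open>a\<close>; the result \<open>h'\<close> has the same
  image as \<open>g\<close>, as both images are restrictions of \<open>\<phi> h\<close> to the same identity. The equation
  \<open>agb = h'\<close> then has a solution \<open>b\<close> with trivial image.\<close>

lemma qle_iff: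
  assumes "g \<in> Arr G" "h \<in> Arr G"
  shows "qle G K g h \<longleftrightarrow> Dom G g \<unlhd> Dom G h \<and> \<phi> g \<preceq>\<^bsub>H\<^esub> \<phi> h"
proof
  assume "qle G K g h"
  then obtain a b where ab: "a \<in> K" "b \<in> K" "Rng G a = Dom G g" "Rng G g = Dom G b"
    "a \<cdot>\<^bsub>G\<^esub> g \<cdot>\<^bsub>G\<^esub> b \<preceq>\<^bsub>G\<^esub> h"
    unfolding qle_def by blast
  have "Dom G a \<preceq>\<^bsub>G\<^esub> Dom G h"
    using ab assms G.Dom_mono[of "a \<cdot>\<^bsub>G\<^esub> g \<cdot>\<^bsub>G\<^esub> b" h] by simp
  then have "Dom G g \<unlhd> Dom G h"
    unfolding dominated_def using ab by blast
  moreover have "Rng H (\<phi> a) = Dom H (\<phi> g)" "Rng H (\<phi> g) = Dom H (\<phi> b)"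
    using ab assms by (simp_all flip: map_Dom map_Rng)
  then have "\<phi> (a \<cdot>\<^bsub>G\<^esub> g \<cdot>\<^bsub>G\<^esub> b) = \<phi> g"
    using ab assms Ker_map[of a] Ker_map[of b] by simp
  then have "\<phi> g \<preceq>\<^bsub>H\<^esub> \<phi> h"
    using ab assms map_Le[of "a \<cdot>\<^bsub>G\<^esub> g \<cdot>\<^bsub>G\<^esub> b" h] by simp
  ultimately show "Dom G g \<unlhd> Dom G h \<and> \<phi> g \<preceq>\<^bsub>H\<^esub> \<phi> h" ..
next
  assume "Dom G g \<unlhd> Dom G h \<and> \<phi> g \<preceq>\<^bsub>H\<^esub> \<phi> h"
  then obtain a where a: "a \<in> K" "Rng G a = Dom G g" "Dom G a \<preceq>\<^bsub>G\<^esub> Dom G h"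
    and le: "\<phi> g \<preceq>\<^bsub>H\<^esub> \<phi> h"
    unfolding dominated_def by blast
  define h' where "h' = restr G (Dom G a) h"
  have h': "h' \<in> Arr G" "h' \<preceq>\<^bsub>G\<^esub> h" "Dom G h' = Dom G a"
    using a assms G.restr_props[of h "Dom G a"] by (simp_all add: h'_def)
  have "Dom H (\<phi> h') = Dom H (\<phi> g)"
    using h' a assms Ker_map_Dom[of a] Ker_map_Rng[of a] map_Dom[of h'] map_Dom[of a] map_Rng[of a] map_Dom[of g]
    by simp
  then have eq: "\<phi> h' = \<phi> g"
    using H.Le_unique_Dom[of "\<phi> h'" "\<phi> h" "\<phi> g"] map_Le[of h' h] h' le assms by simp
  define b where "b = Inv G g \<cdot>\<^bsub>G\<^esub> (Inv G a \<cdot>\<^bsub>G\<^esub> h')"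
  have b: "b \<in> Arr G" "Dom G b = Rng G g"
    using a h' assms by (simp_all add: b_def)
  have "Rng H (\<phi> a) = Dom H (\<phi> g)"
    using a assms by (simp flip: map_Dom map_Rng)
  then have "\<phi> b = Rng H (\<phi> g)"
    using a h' assms eq Ker_map[of a] by (simp add: b_def)
  then have "b \<in> K"
    using b assms by (intro KerI) simp_all
  moreover have "a \<cdot>\<^bsub>G\<^esub> g \<cdot>\<^bsub>G\<^esub> b = h'"
    using a h' assms b by (simp add: G.Comp_assoc) (simp add: b_def)
  ultimately show "qle G K g h"
    unfolding qle_def using a b h' by (intro bexI[of _ a] bexI[of _ b]) simp_all
qed

lemma qle_Ids: "\<lbrakk>e \<in> Ids G; f \<in> Ids G\<rbrakk> \<Longrightarrow> qle G K e f \<longleftrightarrow> e \<unlhd> f"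
  using dominated_map[of e f] by (auto simp: qle_iff)

text \<open>If \<open>agb \<le> h\<close>, then the inverse of \<open>b\<close> witnesses the domination. This makes inversion
  compatible with the preorder, although \<open>qle_iff\<close> is stated through domains only.\<close>

lemma qle_imp_dominated_Rng:
  assumes "qle G K g h" "g \<in> Arr G" "h \<in> Arr G"
  shows "Rng G g \<unlhd> Rng G h"
proof -
  obtain a b where ab: "a \<in> K" "b \<in> K" "Rng G a = Dom G g" "Rng G g = Dom G b"
    "a \<cdot>\<^bsub>G\<^esub> g \<cdot>\<^bsub>G\<^esub> b \<preceq>\<^bsub>G\<^esub> h"
    using assms unfolding qle_def by blast
  then have "Rng G b \<preceq>\<^bsub>G\<^esub> Rng G h"
    using assms G.Rng_mono[of "a \<cdot>\<^bsub>G\<^esub> g \<cdot>\<^bsub>G\<^esub> b" h] by simp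
  then show ?thesis
    unfolding dominated_def using ab by (intro bexI[of _ "Inv G b"]) simp_all
qed

lemma qle_refl: "g \<in> Arr G \<Longrightarrow> qle G K g g"
  by (simp add: qle_iff)

lemma qle_trans:
  "\<lbrakk>qle G K g h; qle G K h k; g \<in> Arr G; h \<in> Arr G; k \<in> Arr G\<rbrakk> \<Longrightarrow> qle G K g k"
  using dominated_trans[of "Dom G g" "Dom G h" "Dom G k"] H.Le_transE[of "\<phi> g" "\<phi> h" "\<phi> k"]
  by (simp add: qle_iff)

lemma equiv_qrel: "equiv (Arr G) (qrel G K)"
  by (rule equivI) (auto simp: qrel_def refl_on_def sym_def trans_def qle_refl intro: qle_trans)

lemma in_cls_iff: "h \<in> cls g \<longleftrightarrow> g \<in> Arr G \<and> h \<in> Arr G \<and> cls g = cls h"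
  unfolding qclass_def using eq_equiv_class_iff[OF equiv_qrel, of g h]
  by (auto simp: qrel_def)

lemma cls_eq_iff_qle:
  "\<lbrakk>g \<in> Arr G; h \<in> Arr G\<rbrakk> \<Longrightarrow> cls g = cls h \<longleftrightarrow> qle G K g h \<and> qle G K h g"
  unfolding qclass_def using eq_equiv_class_iff[OF equiv_qrel, of g h] by (simp add: qrel_def)

lemma cls_Ids_eq_iff: "\<lbrakk>e \<in> Ids G; f \<in> Ids G\<rbrakk> \<Longrightarrow> cls e = cls f \<longleftrightarrow> e \<unlhd> f \<and> f \<unlhd> e"
  by (simp add: cls_eq_iff_qle qle_Ids)

text \<open>Below, this criterion turns every equation in the quotient into an equation of domain classes
  and an equation in \<open>H\<close>.\<close>

lemma cls_eq_iff:
  "\<lbrakk>g \<in> Arr G; h \<in> Arr G\<rbrakk> \<Longrightarrow> cls g = cls h \<longleftrightarrow> cls (Dom G g) = cls (Dom G h) \<and> \<phi> g = \<phi> h"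
  by (auto simp: cls_eq_iff_qle[of g h] cls_Ids_eq_iff qle_iff intro: H.Le_antisymE)

lemma cls_eqI:
  "\<lbrakk>g \<in> Arr G; h \<in> Arr G; cls (Dom G g) = cls (Dom G h); \<phi> g = \<phi> h\<rbrakk> \<Longrightarrow> cls g = cls h"
  using cls_eq_iff by blast

lemma cls_map_cong: "\<lbrakk>cls g = cls h; g \<in> Arr G; h \<in> Arr G\<rbrakk> \<Longrightarrow> \<phi> g = \<phi> h"
  using cls_eq_iff by blast

lemma cls_Dom_cong: "\<lbrakk>cls g = cls h; g \<in> Arr G; h \<in> Arr G\<rbrakk> \<Longrightarrow> cls (Dom G g) = cls (Dom G h)"
  using cls_eq_iff by blast

lemma cls_Rng_cong: "\<lbrakk>cls g = cls h; g \<in> Arr G; h \<in> Arr G\<rbrakk> \<Longrightarrow> cls (Rng G g) = cls (Rng G h)"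
  by (simp add: cls_eq_iff_qle[of g h] cls_Ids_eq_iff qle_imp_dominated_Rng)

lemma cls_Rng_eq_map:
  assumes "cls (Rng G g) = cls (Dom G h)" "g \<in> Arr G" "h \<in> Arr G"
  shows "Rng H (\<phi> g) = Dom H (\<phi> h)"
  using assms cls_map_cong[OF assms(1)] by simp

lemma Arr_quot: "X \<in> Arr Q \<longleftrightarrow> (\<exists>g \<in> Arr G. X = cls g)"
  by (auto simp: quot_def quotient_def qclass_def)

lemma cls_in_Arr [simp]: "g \<in> Arr G \<Longrightarrow> cls g \<in> Arr Q"
  using Arr_quot by blast

lemma Dom_quot [simp]:
  assumes "g \<in> Arr G"
  shows "Dom Q (cls g) = cls (Dom G g)"
proof -
  have "cls g \<noteq> {}"
    using assms in_cls_iff[of g g] by blast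
  then have "the_elem ((\<lambda>g. cls (Dom G g)) ` cls g) = cls (Dom G g)"
    by (rule the_elem_image_unique) (metis in_cls_iff cls_Dom_cong)
  then show ?thesis
    by (simp add: quot_def)
qed

lemma Rng_quot [simp]:
  assumes "g \<in> Arr G"
  shows "Rng Q (cls g) = cls (Rng G g)"
proof -
  have "cls g \<noteq> {}"
    using assms in_cls_iff[of g g] by blast
  then have "the_elem ((\<lambda>g. cls (Rng G g)) ` cls g) = cls (Rng G g)"
    by (rule the_elem_image_unique) (metis in_cls_iff cls_Rng_cong)
  then show ?thesis
    by (simp add: quot_def)
qed

lemma induced_cls [simp]:
  assumes "g \<in> Arr G"
  shows "induced \<phi> (cls g) = \<phi> g"
proof -
  have "cls g \<noteq> {}"
    using assms in_cls_iff[of g g] by blast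
  then have "the_elem (\<phi> ` cls g) = \<phi> g"
    by (rule the_elem_image_unique) (metis in_cls_iff cls_map_cong)
  then show ?thesis
    by (simp add: induced_def)
qed

lemma Le_quot [simp]:
  assumes "g \<in> Arr G" "h \<in> Arr G"
  shows "cls g \<preceq>\<^bsub>Q\<^esub> cls h \<longleftrightarrow> qle G K g h"
proof
  assume "cls g \<preceq>\<^bsub>Q\<^esub> cls h"
  then obtain g' h' where "g' \<in> cls g" "h' \<in> cls h" "qle G K g' h'"
    by (auto simp: quot_def)
  with assms show "qle G K g h"
    by (auto simp: in_cls_iff cls_eq_iff_qle) (meson qle_trans)
next
  assume "qle G K g h"
  moreover have "g \<in> cls g" "h \<in> cls h"
    using assms by (simp_all add: in_cls_iff)
  ultimately show "cls g \<preceq>\<^bsub>Q\<^esub> cls h"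
    by (auto simp: quot_def)
qed

text \<open>The image is found by the uniqueness of corestrictions in \<open>H\<close>: mutual domination forces the
  images of the range of \<open>g\<close> and of the domain of \<open>a\<close> to agree, so corestricting \<open>g\<close> does not
  change its image. The domain class survives because the second half \<open>q\<close> of the nexus shows that
  the corestricted range still dominates the range of \<open>g\<close>, and the preorder passes to inverses.\<close>

lemma nexus_composite:
  assumes g: "g \<in> Arr G" and h: "h \<in> Arr G" and "nexus G K (Rng G g) (Dom G h) a q"
  defines "m \<equiv> corestr G g (Dom G a) \<cdot>\<^bsub>G\<^esub> a \<cdot>\<^bsub>G\<^esub> h"
  shows "m \<in> Arr G" "cls (Dom G m) = cls (Dom G g)" "\<phi> m = \<phi> g \<cdot>\<^bsub>H\<^esub> \<phi> h"
proof -
  have a: "a \<in> K" "Dom G a \<preceq>\<^bsub>G\<^esub> Rng G g" "Rng G a = Dom G h"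
    and q: "q \<in> K" "Dom G q \<preceq>\<^bsub>G\<^esub> Dom G h" "Rng G q = Rng G g"
    using assms(3) by (auto simp: nexus_def)
  have mutual: "Dom G h \<unlhd> Rng G g" "Rng G g \<unlhd> Dom G h"
    unfolding dominated_def using a q by blast+
  then have eq: "cls (Rng G g) = cls (Dom G h)"
    using g h by (simp add: cls_Ids_eq_iff)
  have comp: "Rng H (\<phi> g) = Dom H (\<phi> h)"
    using cls_Rng_eq_map[OF eq g h] .
  have map_a: "Rng H (\<phi> a) = Dom H (\<phi> h)"
    using a h by (simp flip: map_Dom map_Rng)
  define g' where "g' = corestr G g (Dom G a)"
  have g': "g' \<in> Arr G" "g' \<preceq>\<^bsub>G\<^esub> g" "Rng G g' = Dom G a"
    using a g G.corestr_props[of g "Dom G a"] by (simp_all add: g'_def)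
  have "Rng H (\<phi> g') = Rng H (\<phi> g)"
    using g' a comp map_a Ker_map_Dom[of a] Ker_map_Rng[of a] map_Rng[of g'] by simp
  then have map_g': "\<phi> g' = \<phi> g"
    using H.Le_unique_Rng[of "\<phi> g'" "\<phi> g" "\<phi> g"] map_Le[of g' g] g' g by simp
  show "m \<in> Arr G"
    using g' a h by (simp add: m_def flip: g'_def)
  show "\<phi> m = \<phi> g \<cdot>\<^bsub>H\<^esub> \<phi> h"
    using g' a g h map_g' comp map_a Ker_map[of a] by (simp add: m_def flip: g'_def)
  have "Dom G a \<unlhd> Rng G g" "Rng G g \<unlhd> Dom G a"
    using a mutual Ker_dominated[of a] g h
      dominated_trans[of "Dom G a" "Dom G h" "Rng G g"] dominated_trans[of "Rng G g" "Dom G h" "Dom G a"]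
    by simp_all
  then have "Rng G g \<unlhd> Rng G g'"
    using g' by simp
  \<comment> \<open>Inverting turns domination of ranges, which the nexus provides, into domination of domains.\<close>
  then have "qle G K (Inv G g) (Inv G g')"
    using g g' map_g' by (simp add: qle_iff)
  then have "Dom G g \<unlhd> Dom G g'"
    using qle_imp_dominated_Rng[of "Inv G g" "Inv G g'"] g g' by simp
  moreover have "Dom G g' \<unlhd> Dom G g"
    using g g' by (intro Le_imp_dominated G.Dom_mono) simp_all
  ultimately show "cls (Dom G m) = cls (Dom G g)"
    using g' a g h by (simp add: m_def cls_Ids_eq_iff flip: g'_def)
qed

lemma Comp_quot:
  assumes g: "g \<in> Arr G" and h: "h \<in> Arr G" and gh: "cls (Rng G g) = cls (Dom G h)"
  obtains m where "m \<in> Arr G" "cls g \<cdot>\<^bsub>Q\<^esub> cls h = cls m"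
    "cls (Dom G m) = cls (Dom G g)" "cls (Rng G m) = cls (Rng G h)" "\<phi> m = \<phi> g \<cdot>\<^bsub>H\<^esub> \<phi> h"
proof -
  let ?m = "\<lambda>g h a. corestr G g (Dom G a) \<cdot>\<^bsub>G\<^esub> a \<cdot>\<^bsub>G\<^esub> h"
  have "Dom G h \<unlhd> Rng G g" "Rng G g \<unlhd> Dom G h"
    using assms by (simp_all add: cls_Ids_eq_iff)
  then obtain a q where n: "nexus G K (Rng G g) (Dom G h) a q"
    unfolding dominated_def nexus_def by blast
  then have a: "a \<in> K" "Dom G a \<preceq>\<^bsub>G\<^esub> Rng G g" "Rng G a = Dom G h"
    by (auto simp: nexus_def)
  note m = nexus_composite[OF g h n]
  have uniq: "cls (?m g' h' a') = cls (?m g h a)"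
    if "g' \<in> cls g" "h' \<in> cls h" "nexus G K (Rng G g') (Dom G h') a' q'" for g' h' a' q'
  proof -
    have gh': "g' \<in> Arr G" "h' \<in> Arr G" "cls g' = cls g" "cls h' = cls h"
      using that by (simp_all add: in_cls_iff)
    note m' = nexus_composite[OF gh'(1,2) that(3)]
    show ?thesis
    proof (rule cls_eqI[OF m'(1) m(1)])
      show "cls (Dom G (?m g' h' a')) = cls (Dom G (?m g h a))"
        unfolding m'(2) m(2) by (rule cls_Dom_cong[OF gh'(3,1) g])
      show "\<phi> (?m g' h' a') = \<phi> (?m g h a)"
        unfolding m'(3) m(3) cls_map_cong[OF gh'(3,1) g] cls_map_cong[OF gh'(4,2) h] ..
    qed
  qed
  let ?S = "{cls (?m g' h' a') | g' h' a' q'. g' \<in> cls g \<and> h' \<in> cls h \<and>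
      nexus G K (Rng G g') (Dom G h') a' q'}"
  have "g \<in> cls g" "h \<in> cls h"
    using g h by (simp_all add: in_cls_iff)
  then have "cls (?m g h a) \<in> ?S"
    using n by blast
  moreover have "?S \<subseteq> {cls (?m g h a)}"
    using uniq by blast
  ultimately have "?S = {cls (?m g h a)}"
    by blast
  then have "cls g \<cdot>\<^bsub>Q\<^esub> cls h = cls (?m g h a)"
    by (simp add: quot_def)
  moreover have "Rng G (?m g h a) = Rng G h"
    using a g h G.corestr_props[of g "Dom G a"] by simp
  ultimately show ?thesis
    using that m by simp
qed

text \<open>To compute a composite in the quotient it suffices to guess an arrow with the right domain
  class and the right image; no nexus has to be produced.\<close>

lemma Comp_quot_eqI:
  assumes "g \<in> Arr G" "h \<in> Arr G" "k \<in> Arr G" "cls (Rng G g) = cls (Dom G h)"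
    "cls (Dom G k) = cls (Dom G g)" "\<phi> k = \<phi> g \<cdot>\<^bsub>H\<^esub> \<phi> h"
  shows "cls g \<cdot>\<^bsub>Q\<^esub> cls h = cls k"
proof -
  obtain m where "m \<in> Arr G" "cls g \<cdot>\<^bsub>Q\<^esub> cls h = cls m"
    "cls (Dom G m) = cls (Dom G g)" "\<phi> m = \<phi> g \<cdot>\<^bsub>H\<^esub> \<phi> h"
    using Comp_quot assms by metis
  with assms show ?thesis
    by (simp add: cls_eq_iff[of m k])
qed

lemma groupoid_quot: "groupoid Q"
proof (rule groupoid.intro, goal_cases)
  case (7 X Y)
  then obtain g h where gh: "g \<in> Arr G" "X = cls g" "h \<in> Arr G" "Y = cls h" by (auto simp: Arr_quot)
  have 0: "cls (Rng G g) = cls (Dom G h)"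
    using 7 gh by simp
  obtain m where "m \<in> Arr G" "X \<cdot>\<^bsub>Q\<^esub> Y = cls m"
    using Comp_quot[of g h] gh 0 by metis
  then show ?case by simp
next
  case (8 X Y)
  then obtain g h where gh: "g \<in> Arr G" "X = cls g" "h \<in> Arr G" "Y = cls h" by (auto simp: Arr_quot)
  have 0: "cls (Rng G g) = cls (Dom G h)"
    using 8 gh by simp
  obtain m where "m \<in> Arr G" "X \<cdot>\<^bsub>Q\<^esub> Y = cls m" "cls (Dom G m) = cls (Dom G g)"
    using Comp_quot[of g h] gh 0 by metis
  then show ?case using gh by simp
next
  case (9 X Y)
  then obtain g h where gh: "g \<in> Arr G" "X = cls g" "h \<in> Arr G" "Y = cls h" by (auto simp: Arr_quot)
  have 0: "cls (Rng G g) = cls (Dom G h)"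
    using 9 gh by simp
  obtain m where "m \<in> Arr G" "X \<cdot>\<^bsub>Q\<^esub> Y = cls m" "cls (Rng G m) = cls (Rng G h)"
    using Comp_quot[of g h] gh 0 by metis
  then show ?case using gh by simp
next
  case (12 X Y Z)
  then obtain g h k where ghk: "g \<in> Arr G" "X = cls g" "h \<in> Arr G" "Y = cls h" "k \<in> Arr G" "Z = cls k"
    by (auto simp: Arr_quot)
  have rh: "cls (Rng G g) = cls (Dom G h)" and rk: "cls (Rng G h) = cls (Dom G k)"
    using 12 ghk by simp_all
  obtain m where m: "m \<in> Arr G" "X \<cdot>\<^bsub>Q\<^esub> Y = cls m" "cls (Dom G m) = cls (Dom G g)"
      "cls (Rng G m) = cls (Rng G h)" "\<phi> m = \<phi> g \<cdot>\<^bsub>H\<^esub> \<phi> h"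
    using ghk rh Comp_quot[of g h] by metis
  obtain n where n: "n \<in> Arr G" "Y \<cdot>\<^bsub>Q\<^esub> Z = cls n" "cls (Dom G n) = cls (Dom G h)"
      "cls (Rng G n) = cls (Rng G k)" "\<phi> n = \<phi> h \<cdot>\<^bsub>H\<^esub> \<phi> k"
    using ghk rk Comp_quot[of h k] by metis
  obtain l where l: "l \<in> Arr G" "X \<cdot>\<^bsub>Q\<^esub> cls n = cls l" "cls (Dom G l) = cls (Dom G g)"
      "\<phi> l = \<phi> g \<cdot>\<^bsub>H\<^esub> \<phi> n"
    using ghk rh n Comp_quot[of g n] by metis
  have "Rng H (\<phi> g) = Dom H (\<phi> h)" "Rng H (\<phi> h) = Dom H (\<phi> k)"
    using cls_Rng_eq_map rh rk ghk by simp_all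
  then have "cls m \<cdot>\<^bsub>Q\<^esub> Z = cls l"
    using m n l ghk rk by (simp add: Comp_quot_eqI H.Comp_assoc)
  then show ?case
    using m n l by simp
next
  case (13 X)
  then obtain g where "g \<in> Arr G" "X = cls g" by (auto simp: Arr_quot)
  then show ?case
    by (intro bexI[of _ "cls (Inv G g)"]) (simp_all add: Comp_quot_eqI)
qed (auto simp: Arr_quot Comp_quot_eqI)

lemma Inv_quot [simp]:
  assumes "g \<in> Arr G"
  shows "Inv Q (cls g) = cls (Inv G g)"
  using assms by (intro groupoid.Inv_eqI[OF groupoid_quot]) (simp_all add: Comp_quot_eqI)

lemma Ids_quot: "X \<in> Ids Q \<longleftrightarrow> (\<exists>e \<in> Ids G. X = cls e)"
proof
  assume "X \<in> Ids Q"
  then obtain g where "g \<in> Arr G" "X = cls g" "Dom Q X = X"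
    by (auto simp: Ids_def[of Q] Arr_quot)
  then show "\<exists>e \<in> Ids G. X = cls e"
    by (intro bexI[of _ "Dom G g"]) simp_all
next
  assume "\<exists>e \<in> Ids G. X = cls e"
  then show "X \<in> Ids Q"
    by (auto simp: Ids_def[of Q])
qed

lemma ordered_groupoid_quot: "ordered_groupoid Q"
proof (intro ordered_groupoid.intro groupoid_quot ordered_groupoid_axioms.intro, goal_cases)
  case 1
  show ?case by (rule reflp_onI) (metis Arr_quot Le_quot qle_refl)
next
  case 2
  show ?case by (rule antisymp_onI) (metis Arr_quot Le_quot cls_eq_iff_qle)
next
  case 3
  show ?case by (rule transp_onI) (metis Arr_quot Le_quot qle_trans)
next
  case (4 X Y)
  then obtain g h where gh: "g \<in> Arr G" "X = cls g" "h \<in> Arr G" "Y = cls h" by (auto simp: Arr_quot)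
  then have "qle G K g h"
    using 4 by simp
  then have "qle G K (Inv G g) (Inv G h)"
    using gh qle_imp_dominated_Rng[of g h] H.OG1[of "\<phi> g" "\<phi> h"] by (simp add: qle_iff)
  then show ?case
    using gh by simp
next
  case (5 X1 X2 Y1 Y2)
  then obtain g1 g2 h1 h2 where gh: "g1 \<in> Arr G" "X1 = cls g1" "g2 \<in> Arr G" "X2 = cls g2"
    "h1 \<in> Arr G" "Y1 = cls h1" "h2 \<in> Arr G" "Y2 = cls h2" by (auto simp: Arr_quot)
  have r: "cls (Rng G g1) = cls (Dom G h1)" "cls (Rng G g2) = cls (Dom G h2)"
    and le: "qle G K g1 g2" "qle G K h1 h2"
    using 5 gh by simp_all
  obtain m1 where m1: "m1 \<in> Arr G" "X1 \<cdot>\<^bsub>Q\<^esub> Y1 = cls m1" "cls (Dom G m1) = cls (Dom G g1)"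
      "\<phi> m1 = \<phi> g1 \<cdot>\<^bsub>H\<^esub> \<phi> h1"
    using gh r Comp_quot[of g1 h1] by metis
  obtain m2 where m2: "m2 \<in> Arr G" "X2 \<cdot>\<^bsub>Q\<^esub> Y2 = cls m2" "cls (Dom G m2) = cls (Dom G g2)"
      "\<phi> m2 = \<phi> g2 \<cdot>\<^bsub>H\<^esub> \<phi> h2"
    using gh r Comp_quot[of g2 h2] by metis
  have "Dom G m1 \<unlhd> Dom G g2"
    using m1 le gh dominated_trans[of "Dom G m1" "Dom G g1" "Dom G g2"]
    by (simp add: qle_iff cls_Ids_eq_iff)
  then have "Dom G m1 \<unlhd> Dom G m2"
    using m1 m2 le gh dominated_trans[of "Dom G m1" "Dom G g2" "Dom G m2"]
    by (simp add: cls_Ids_eq_iff)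
  moreover have "\<phi> m1 \<preceq>\<^bsub>H\<^esub> \<phi> m2"
    using m1 m2 le gh r cls_Rng_eq_map by (simp add: qle_iff H.OG2)
  ultimately show ?case
    using m1 m2 by (simp add: qle_iff)
next
  case (6 X F)
  then obtain g f where g: "g \<in> Arr G" "X = cls g" and f: "f \<in> Ids G" "F = cls f"
    by (auto simp: Arr_quot Ids_quot)
  have "f \<unlhd> Dom G g"
    using 6 g f by (simp add: qle_Ids)
  then obtain a where a: "a \<in> K" "Rng G a = f" "Dom G a \<preceq>\<^bsub>G\<^esub> Dom G g"
    unfolding dominated_def by blast
  define x where "x = restr G (Dom G a) g"
  have x: "x \<in> Arr G" "x \<preceq>\<^bsub>G\<^esub> g" "Dom G x = Dom G a"
    using a g G.restr_props[of g "Dom G a"] by (simp_all add: x_def)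
  show ?case
  proof (rule ex1I[of _ "cls x"])
    have "cls (Dom G x) = F"
      using a x f Ker_dominated[of a] by (simp add: cls_Ids_eq_iff)
    moreover have "qle G K x g"
      using x g a map_Le[of x g] Le_imp_dominated[of "Dom G a" "Dom G g"] by (simp add: qle_iff)
    ultimately show "cls x \<in> Arr Q \<and> cls x \<preceq>\<^bsub>Q\<^esub> X \<and> Dom Q (cls x) = F"
      using x g by simp
    fix Y
    assume Y: "Y \<in> Arr Q \<and> Y \<preceq>\<^bsub>Q\<^esub> X \<and> Dom Q Y = F"
    then obtain y where y: "y \<in> Arr G" "Y = cls y"
      by (auto simp: Arr_quot)
    have le: "\<phi> y \<preceq>\<^bsub>H\<^esub> \<phi> g" "\<phi> x \<preceq>\<^bsub>H\<^esub> \<phi> g" and d: "cls (Dom G y) = cls (Dom G x)"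
      using Y y x g \<open>qle G K x g\<close> \<open>cls (Dom G x) = F\<close> by (simp_all add: qle_iff)
    have "Dom H (\<phi> y) = Dom H (\<phi> x)"
      using cls_map_cong[OF d] x(1) y(1) by (metis G.Dom_closed map_Dom)
    then have "\<phi> y = \<phi> x"
      using H.Le_unique_Dom[of "\<phi> y" "\<phi> g" "\<phi> x"] le x y g by simp
    then show "Y = cls x"
      using y x d by (simp add: cls_eq_iff[of y x])
  qed
qed

lemma ordered_functor_cls: "ordered_functor G Q cls"
proof (intro ordered_functor.intro ordered_functor_axioms.intro ordered_groupoid_quot
    G.ordered_groupoid_axioms)
  fix g h assume "g \<in> Arr G" "h \<in> Arr G" "Rng G g = Dom G h"
  then show "cls (g \<cdot>\<^bsub>G\<^esub> h) = cls g \<cdot>\<^bsub>Q\<^esub> cls h"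
    by (intro Comp_quot_eqI[symmetric]) simp_all
next
  show "monotone_on (Arr G) (Le G) (Le Q) cls"
    by (auto simp: monotone_on_def qle_iff intro: map_Le Le_imp_dominated G.Dom_mono)
qed simp_all

lemma ordered_functor_induced: "ordered_functor Q H (induced \<phi>)"
proof (intro ordered_functor.intro ordered_functor_axioms.intro ordered_groupoid_quot
    H.ordered_groupoid_axioms)
  fix X Y assume XY: "X \<in> Arr Q" "Y \<in> Arr Q" "Rng Q X = Dom Q Y"
  then obtain g h where gh: "g \<in> Arr G" "X = cls g" "h \<in> Arr G" "Y = cls h"
    by (auto simp: Arr_quot)
  then have "cls (Rng G g) = cls (Dom G h)"
    using XY by simp
  then obtain m where "m \<in> Arr G" "X \<cdot>\<^bsub>Q\<^esub> Y = cls m" "\<phi> m = \<phi> g \<cdot>\<^bsub>H\<^esub> \<phi> h"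
    using Comp_quot[of g h] gh by metis
  then show "induced \<phi> (X \<cdot>\<^bsub>Q\<^esub> Y) = induced \<phi> X \<cdot>\<^bsub>H\<^esub> induced \<phi> Y"
    using gh by simp
next
  show "monotone_on (Arr Q) (Le Q) (Le H) (induced \<phi>)"
    by (auto simp: monotone_on_def Arr_quot qle_iff)
qed (auto simp: Arr_quot)

text \<open>Two arrows in one star of the quotient have the same domain class, so by \<open>cls_eq_iff\<close> they are
  told apart by their images.\<close>

lemma covering_induced:
  assumes star_surj: "\<And>e k. \<lbrakk>e \<in> Ids G; k \<in> Arr H; Dom H k = \<phi> e\<rbrakk>
    \<Longrightarrow> \<exists>m \<in> Arr G. Dom G m = e \<and> \<phi> m = k"
  shows "covering Q H (induced \<phi>)"
  unfolding covering_def
proof (intro conjI ballI ordered_functor_induced)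
  fix X assume "X \<in> Ids Q"
  then obtain e where e: "e \<in> Ids G" "X = cls e"
    by (auto simp: Ids_quot)
  show "bij_betw (induced \<phi>) (Star Q X) (Star H (induced \<phi> X))"
  proof (rule bij_betwI')
    fix Y Z assume "Y \<in> Star Q X" "Z \<in> Star Q X"
    then obtain g h where "g \<in> Arr G" "Y = cls g" "h \<in> Arr G" "Z = cls h" "cls (Dom G g) = cls (Dom G h)"
      by (auto simp: Star_def Arr_quot)
    then show "induced \<phi> Y = induced \<phi> Z \<longleftrightarrow> Y = Z"
      by (simp add: cls_eq_iff[of g h])
  next
    fix Y assume "Y \<in> Star Q X"
    then obtain g where "g \<in> Arr G" "Y = cls g" "cls (Dom G g) = cls e"
      using e by (auto simp: Star_def Arr_quot)
    then show "induced \<phi> Y \<in> Star H (induced \<phi> X)"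
      using e cls_map_cong[of "Dom G g" e] by (auto simp: Star_def)
  next
    fix k assume "k \<in> Star H (induced \<phi> X)"
    then obtain m where "m \<in> Arr G" "Dom G m = e" "\<phi> m = k"
      using star_surj[of e k] e by (auto simp: Star_def)
    then show "\<exists>Y \<in> Star Q X. k = induced \<phi> Y"
      using e by (intro bexI[of _ "cls m"]) (auto simp: Star_def)
  qed
qed

end


section \<open>Lifting through a factorization\<close>

lemma ordered_functor_compose:
  assumes "ordered_functor F G p" "ordered_functor G H q"
  shows "ordered_functor F H (\<lambda>x. q (p x))"
proof -
  interpret p: ordered_functor F G p by fact
  interpret q: ordered_functor G H q by fact
  show ?thesis
    by unfold_locales (simp_all add: p.map_composable monotone_on_def p.map_Le q.map_Le)
qed

text \<open>Once the two lifts agree on the domain of \<open>x\<close>, their values at \<open>x\<close> lie in one star, on which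
  \<open>q\<close> is injective.\<close>

lemma covering_unique_lift:
  assumes "covering Q H q" "ordered_functor P Q S" "ordered_functor P Q T"
    and "q (S x) = q (T x)" "S (Dom P x) = T (Dom P x)" "x \<in> Arr P"
  shows "S x = T x"
proof -
  interpret S: ordered_functor P Q S by fact
  interpret T: ordered_functor P Q T by fact
  have "inj_on q (Star Q (S (Dom P x)))"
    using assms S.map_Ids[of "Dom P x"] unfolding covering_def bij_betw_def by simp
  moreover have "S x \<in> Star Q (S (Dom P x))" "T x \<in> Star Q (S (Dom P x))"
    using assms T.map_Dom[of x] by (simp_all add: Star_def)
  ultimately show ?thesis
    using assms by (simp add: inj_on_eq_iff)
qed

lemma prod_interval_simps [simp]:
  "(a, i) \<in> Arr (prod_ogpd A interval) \<longleftrightarrow> a \<in> Arr A"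
  "Dom (prod_ogpd A interval) (a, i) = (Dom A a, interval_dom i)"
  "Rng (prod_ogpd A interval) (a, i) = (Rng A a, interval_rng i)"
  "Comp (prod_ogpd A interval) (a, i) (b, j) = (Comp A a b, interval_comp i j)"
  "Le (prod_ogpd A interval) (a, i) (b, j) \<longleftrightarrow> Le A a b \<and> i = j"
  by (simp_all add: prod_ogpd_def interval_def)

text \<open>Lift \<open>q \<circ> F\<close> along \<open>p\<close> to \<open>F'\<close>. The functors \<open>r \<circ> F'\<close> and \<open>F\<close> agree on \<open>A \<times> 0\<close>, hence on the
  arrows \<open>(e, \<iota>)\<close> for identities \<open>e\<close> and on their ranges \<open>(e, 1)\<close>, hence on all objects, hence
  everywhere by unique lifting.\<close>

lemma strong_fibration_of_covering_factor:
  assumes p: "strong_fibration TYPE('c) G H p" and r: "ordered_functor G Q r"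
    and q: "covering Q H q" and qr: "\<And>g. g \<in> Arr G \<Longrightarrow> q (r g) = p g"
  shows "strong_fibration TYPE('c) G Q r"
  unfolding strong_fibration_def
proof (intro conjI allI impI r)
  fix A :: "'c ogpd" and f F
  let ?P = "prod_ogpd A interval"
  assume A: "ordered_groupoid A" and f: "ordered_functor A G f" and F: "ordered_functor ?P Q F"
    and rf: "\<forall>a \<in> Arr A. r (f a) = F (a, I0)"
  interpret A: ordered_groupoid A by fact
  interpret f: ordered_functor A G f by fact
  have qF: "ordered_functor ?P H (\<lambda>x. q (F x))"
    using F q ordered_functor_compose unfolding covering_def by blast
  have pf: "p (f a) = q (F (a, I0))" if "a \<in> Arr A" for a
    using that rf qr[of "f a"] by simp
  obtain F' where F': "ordered_functor ?P G F'" "\<forall>a \<in> Arr A. F' (a, I0) = f a"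
    "\<forall>x \<in> Arr ?P. p (F' x) = q (F x)"
    using p[unfolded strong_fibration_def, THEN conjunct2, rule_format, OF A f qF pf] by blast
  interpret F': ordered_functor ?P G F' by fact
  interpret F: ordered_functor ?P Q F by fact
  have rF': "ordered_functor ?P Q (\<lambda>x. r (F' x))"
    using ordered_functor_compose[OF F'(1) r] .
  interpret rF': ordered_functor ?P Q "\<lambda>x. r (F' x)" by fact
  have lift: "r (F' x) = F x" if "x \<in> Arr ?P" "r (F' (Dom ?P x)) = F (Dom ?P x)" for x
    using covering_unique_lift[OF q rF' F] that F' qr by simp
  have zero: "r (F' (e, I0)) = F (e, I0)" if "e \<in> Arr A" for e
    using that rf F' by simp
  have "r (F' (e, I1)) = F (e, I1)" if "e \<in> Ids A" for e
  proof -
    have "r (F' (e, Iota)) = F (e, Iota)"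
      using that lift[of "(e, Iota)"] zero[of e] by simp
    then show ?thesis
      using that rF'.map_Rng[of "(e, Iota)"] F.map_Rng[of "(e, Iota)"] by simp
  qed
  then have objects: "r (F' (e, interval_dom i)) = F (e, interval_dom i)" if "e \<in> Ids A" for e i
    using that zero by (cases i) simp_all
  have "r (F' (a, i)) = F (a, i)" if "a \<in> Arr A" for a i
  proof (rule lift)
    show "r (F' (Dom ?P (a, i))) = F (Dom ?P (a, i))"
      unfolding prod_interval_simps using that by (intro objects) simp
  qed (use that in simp)
  then have "\<forall>x \<in> Arr ?P. r (F' x) = F x"
    by auto
  with F' show "\<exists>F'. ordered_functor ?P G F' \<and> (\<forall>a \<in> Arr A. F' (a, I0) = f a) \<and>
      (\<forall>x \<in> Arr ?P. r (F' x) = F x)"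
    by blast
qed


section \<open>Full order ideals of objects\<close>

text \<open>A full set of arrows over an order ideal of objects is automatically an ordered subgroupoid:
  composites and inverses have their ends in \<open>U\<close>, and so has every restriction of an arrow of \<open>U\<close>,
  since its range lies below a range in \<open>U\<close>.\<close>

lemma (in ordered_groupoid) enlargementI:
  assumes sub: "U \<subseteq> Arr G"
    and Dom_U: "\<And>g. g \<in> U \<Longrightarrow> Dom G g \<in> U" and Rng_U: "\<And>g. g \<in> U \<Longrightarrow> Rng G g \<in> U"
    and ideal: "\<And>f e. \<lbrakk>f \<preceq> e; f \<in> Ids G; e \<in> Ids G; e \<in> U\<rbrakk> \<Longrightarrow> f \<in> U"
    and full: "\<And>g. \<lbrakk>Dom G g \<in> U; Rng G g \<in> U; g \<in> Arr G\<rbrakk> \<Longrightarrow> g \<in> U"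
    and dense: "\<And>e. e \<in> Ids G \<Longrightarrow> \<exists>g \<in> Arr G. Dom G g = e \<and> Rng G g \<in> U"
  shows "enlargement G U"
proof -
  let ?U = "G\<lparr>Arr := U\<rparr>"
  have Arr_U: "g \<in> U \<Longrightarrow> g \<in> Arr G" for g
    using sub by blast
  have Inv_U: "Inv G g \<in> U" if "g \<in> U" for g
    by (rule full) (simp_all add: that Arr_U Dom_U Rng_U)
  have Comp_U: "g \<cdot> h \<in> U" if "g \<in> U" "h \<in> U" "Rng G g = Dom G h" for g h
    by (rule full) (simp_all add: that Arr_U Dom_U Rng_U)
  have "groupoid ?U"
  proof (rule groupoid.intro, goal_cases)
    case (13 g)
    then show ?case
      using Inv_U by (intro bexI[of _ "Inv G g"]) (simp_all add: Arr_U)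
  qed (simp_all add: Arr_U Dom_U Rng_U Comp_U Comp_assoc)
  then have Inv_eq: "g \<in> U \<Longrightarrow> Inv ?U g = Inv G g" for g
    using Inv_U by (intro groupoid.Inv_eqI) (simp_all add: Arr_U)
  have "ordered_groupoid ?U"
  proof (intro ordered_groupoid.intro \<open>groupoid ?U\<close> ordered_groupoid_axioms.intro, goal_cases)
    case 1
    show ?case by (simp add: reflp_on_def Arr_U)
  next
    case 2
    show ?case using Le_antisym sub by (auto intro: antisymp_on_subset)
  next
    case 3
    show ?case using Le_trans sub by (auto intro: transp_on_subset)
  next
    case (4 g h)
    then show ?case by (simp add: Inv_eq OG1 Arr_U)
  next
    case (5 g1 g2 h1 h2)
    then show ?case by (simp add: OG2 Arr_U)
  next
    case (6 g f)
    then have g: "g \<in> U" "g \<in> Arr G" and f: "f \<in> U" "f \<preceq> Dom G g" "Dom G f = f"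
      by (simp_all add: Ids_def[of ?U] Arr_U)
    then have "f \<in> Ids G"
      by (intro IdsI Arr_U)
    obtain x where x: "x \<in> Arr G" "x \<preceq> g" "Dom G x = f"
      using OG3[OF g(2) \<open>f \<in> Ids G\<close> f(2)] by blast
    have "Rng G x \<in> U"
      using x g Rng_mono[of x g] by (intro ideal[of "Rng G x" "Rng G g"] Rng_U) simp_all
    then have "x \<in> U"
      using x f full[of x] by simp
    moreover have "y = x" if "y \<in> U" "y \<preceq> g" "Dom G y = f" for y
      using Le_unique_Dom[OF that(2) x(2) _ Arr_U[OF that(1)] x(1) g(2)] that(3) x(3) by simp
    ultimately have "\<exists>!x. x \<in> U \<and> x \<preceq> g \<and> Dom G x = f"
      using x by blast
    then show ?case
      by simp
  qed
  then show ?thesis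
    unfolding enlargement_def using sub ideal full dense ordered_groupoid_axioms by blast
qed


section \<open>The mapping cocylinder\<close>

text \<open>This is the functoriality of the projection \<open>\<langle>h0, x, h1\<rangle> \<mapsto> h0\<inverse> x h1\<close>.\<close>

lemma (in groupoid) conjugate_Comp:
  assumes "h0 \<in> Arr G" "x \<in> Arr G" "h1 \<in> Arr G" "y \<in> Arr G" "k1 \<in> Arr G"
    and "Dom G h0 = Dom G x" "Rng G x = Dom G h1" "Dom G y = Dom G h1" "Rng G y = Dom G k1"
  shows "(Inv G h0 \<cdot> (x \<cdot> y)) \<cdot> k1 = ((Inv G h0 \<cdot> x) \<cdot> h1) \<cdot> ((Inv G h1 \<cdot> y) \<cdot> k1)"
  using assms by (simp add: Comp_assoc)

context ordered_functor
begin

abbreviation M :: "('b \<times> 'a \<times> 'b) ogpd" where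
  "M \<equiv> cocylinder G H \<phi>"

abbreviation proj :: "'b \<times> 'a \<times> 'b \<Rightarrow> 'b" where
  "proj \<equiv> cocyl_proj H \<phi>"

abbreviation incl :: "'a \<Rightarrow> 'b \<times> 'a \<times> 'b" where
  "incl \<equiv> cocyl_in G \<phi>"

lemma cocyl_simps [simp]:
  "Dom M (h0, a, h1) = (h0, Dom G a, h0)"
  "Rng M (h0, a, h1) = (h1, Rng G a, h1)"
  "(h0, a, h1) \<cdot>\<^bsub>M\<^esub> (k0, b, k1) = (h0, a \<cdot>\<^bsub>G\<^esub> b, k1)"
  "(h0, a, h1) \<preceq>\<^bsub>M\<^esub> (k0, b, k1) \<longleftrightarrow> h0 \<preceq>\<^bsub>H\<^esub> k0 \<and> a \<preceq>\<^bsub>G\<^esub> b \<and> h1 \<preceq>\<^bsub>H\<^esub> k1"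
  by (simp_all add: cocylinder_def)

lemma cocyl_Arr [simp]:
  "(h0, a, h1) \<in> Arr M \<longleftrightarrow>
    h0 \<in> Arr H \<and> a \<in> Arr G \<and> h1 \<in> Arr H \<and> Dom H h0 = Dom H (\<phi> a) \<and> Dom H h1 = Rng H (\<phi> a)"
  by (auto simp: cocylinder_def)

lemma groupoid_cocyl: "groupoid M"
proof (rule groupoid.intro, goal_cases)
  case (13 g)
  obtain h0 a h1 where g: "g = (h0, a, h1)"
    by (cases g)
  show ?case
    using 13 by (intro bexI[of _ "(h1, Inv G a, h0)"]) (simp_all add: g)
next
  case (7 g h)
  then show ?case by (cases g, cases h) simp
next
  case (12 g h k)
  then show ?case by (cases g, cases h, cases k) (simp add: G.Comp_assoc)
qed auto

lemma cocyl_Inv [simp]: "(h0, a, h1) \<in> Arr M \<Longrightarrow> Inv M (h0, a, h1) = (h1, Inv G a, h0)"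
  by (intro groupoid.Inv_eqI[OF groupoid_cocyl]) simp_all

lemma cocyl_Ids: "(h, e, k) \<in> Ids M \<longleftrightarrow> e \<in> Ids G \<and> h \<in> Arr H \<and> k = h \<and> Dom H h = \<phi> e"
proof
  assume "(h, e, k) \<in> Ids M"
  then have "(h, e, k) \<in> Arr M" "Dom G e = e" "k = h"
    by (auto simp: Ids_def[of M])
  then show "e \<in> Ids G \<and> h \<in> Arr H \<and> k = h \<and> Dom H h = \<phi> e"
    using map_Dom[of e] by (auto intro: G.IdsI)
next
  assume "e \<in> Ids G \<and> h \<in> Arr H \<and> k = h \<and> Dom H h = \<phi> e"
  then show "(h, e, k) \<in> Ids M"
    by (auto simp: Ids_def[of M])
qed

text \<open>The restriction of \<open>\<langle>h0, a, h1\<rangle>\<close> to \<open>(e, k)\<close> consists of \<open>k\<close>, of the restriction \<open>a'\<close> of \<open>a\<close> to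
  \<open>e\<close>, and of the restriction of \<open>h1\<close> to the range of the image of \<open>a'\<close>.\<close>

lemma ordered_groupoid_cocyl: "ordered_groupoid M"
proof (intro ordered_groupoid.intro groupoid_cocyl ordered_groupoid_axioms.intro, goal_cases)
  case 1
  show ?case by (auto simp: reflp_on_def)
next
  case 2
  show ?case by (auto simp: antisymp_on_def intro: G.Le_antisymE H.Le_antisymE)
next
  case 3
  show ?case by (auto simp: transp_on_def intro: G.Le_transE H.Le_transE)
next
  case (4 g h)
  then show ?case by (cases g, cases h) (simp add: G.OG1)
next
  case (5 g1 g2 h1 h2)
  then show ?case by (cases g1, cases g2, cases h1, cases h2) (simp add: G.OG2)
next
  case (6 g f)
  obtain h0 a h1 where g: "g = (h0, a, h1)"
    by (cases g)
  obtain k e where f: "f = (k, e, k)" "e \<in> Ids G" "k \<in> Arr H" "Dom H k = \<phi> e"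
    using 6 by (cases f) (auto simp: cocyl_Ids)
  have a: "a \<in> Arr G" "h0 \<in> Arr H" "h1 \<in> Arr H" "Dom H h1 = Rng H (\<phi> a)"
    and le: "k \<preceq>\<^bsub>H\<^esub> h0" "e \<preceq>\<^bsub>G\<^esub> Dom G a"
    using 6 by (auto simp: g f(1))
  define a' where "a' = restr G e a"
  have a': "a' \<in> Arr G" "a' \<preceq>\<^bsub>G\<^esub> a" "Dom G a' = e"
    using a le f G.restr_props[of a e] by (simp_all add: a'_def)
  define k1 where "k1 = restr H (Rng H (\<phi> a')) h1"
  have "Rng H (\<phi> a') \<preceq>\<^bsub>H\<^esub> Dom H h1"
    using a a' by (simp add: H.Rng_mono map_Le)
  then have k1: "k1 \<in> Arr H" "k1 \<preceq>\<^bsub>H\<^esub> h1" "Dom H k1 = Rng H (\<phi> a')"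
    using a a' H.restr_props[of h1 "Rng H (\<phi> a')"] by (simp_all add: k1_def)
  have "Dom H (\<phi> a') = Dom H k"
    using a' f by (simp flip: map_Dom)
  show ?case
  proof (rule ex1I[of _ "(k, a', k1)"])
    show "(k, a', k1) \<in> Arr M \<and> (k, a', k1) \<preceq>\<^bsub>M\<^esub> g \<and> Dom M (k, a', k1) = f"
      using a' k1 f le \<open>Dom H (\<phi> a') = Dom H k\<close> by (simp add: g)
    fix x assume x: "x \<in> Arr M \<and> x \<preceq>\<^bsub>M\<^esub> g \<and> Dom M x = f"
    obtain l b l1 where x_eq: "x = (l, b, l1)"
      by (cases x)
    have b: "b \<in> Arr G" "l = k" "b \<preceq>\<^bsub>G\<^esub> a" "Dom G b = e" "l1 \<in> Arr H" "l1 \<preceq>\<^bsub>H\<^esub> h1"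
      "Dom H l1 = Rng H (\<phi> b)"
      using x by (simp_all add: g f x_eq)
    have "b = a'"
      using G.Le_unique_Dom[of b a a'] b a a' by simp
    moreover have "l1 = k1"
      using H.Le_unique_Dom[of l1 h1 k1] b a k1 \<open>b = a'\<close> by simp
    ultimately show "x = (k, a', k1)"
      using b by (simp add: x_eq)
  qed
qed

lemma proj_eq: "proj (h0, a, h1) = (Inv H h0 \<cdot>\<^bsub>H\<^esub> \<phi> a) \<cdot>\<^bsub>H\<^esub> h1"
  by (simp add: cocyl_proj_def)

lemma ordered_functor_proj: "ordered_functor M H proj"
proof (intro ordered_functor.intro ordered_groupoid_cocyl H.ordered_groupoid_axioms
    ordered_functor_axioms.intro, goal_cases)
  case (4 g h)
  then show ?case
    by (cases g, cases h) (simp add: proj_eq H.conjugate_Comp)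
next
  case 5
  show ?case
    by (auto simp: monotone_on_def proj_eq intro!: H.OG2 H.OG1 map_Le)
qed (auto simp: proj_eq)

lemma proj_star_surj:
  assumes "m \<in> Ids M" "k \<in> Arr H" "Dom H k = proj m"
  shows "\<exists>g \<in> Arr M. Dom M g = m \<and> proj g = k"
proof -
  obtain h e where m: "m = (h, e, h)" "e \<in> Ids G" "h \<in> Arr H" "Dom H h = \<phi> e"
    using assms by (cases m) (auto simp: cocyl_Ids)
  have "proj m = Rng H h"
    using m by (simp add: proj_eq)
  then show ?thesis
    using m assms by (intro bexI[of _ "(h, e, h \<cdot>\<^bsub>H\<^esub> k)"]) (simp_all add: proj_eq)
qed

text \<open>The arrow of the interval from \<open>0\<close> to the given identity.\<close>

fun outgoing :: "interval_arr \<Rightarrow> interval_arr" where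
  "outgoing I0 = I0"
| "outgoing _ = Iota"

text \<open>Write \<open>f a = \<langle>l a, c a, r a\<rangle>\<close> and let \<open>u e i\<close> be the value of \<open>F\<close> on the arrow from \<open>(e, 0)\<close> to
  \<open>(e, i)\<close>. The lift keeps the middle component \<open>c a\<close> and multiplies the two outer ones by values of
  \<open>u\<close> at the ends of the arrow \<open>(a, i)\<close>. It is monotone as a composite of monotone operations, and
  its projection is \<open>F (a, i)\<close> because \<open>F\<close> preserves the commutative square formed by \<open>(a, i)\<close>,
  \<open>(a, 0)\<close> and the arrows from \<open>0\<close> at their two ends.\<close>

lemma strong_fibration_proj: "strong_fibration TYPE('c) M H proj"
  unfolding strong_fibration_def
proof (intro conjI allI impI ordered_functor_proj)
  fix A :: "'c ogpd" and f F
  let ?P = "prod_ogpd A interval"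
  assume A: "ordered_groupoid A" and f: "ordered_functor A M f" and F: "ordered_functor ?P H F"
    and pf: "\<forall>a \<in> Arr A. proj (f a) = F (a, I0)"
  interpret A: ordered_groupoid A by fact
  interpret f: ordered_functor A M f by fact
  interpret F: ordered_functor ?P H F by fact
  interpret M: ordered_groupoid M by (rule ordered_groupoid_cocyl)
  interpret proj: ordered_functor M H proj by (rule ordered_functor_proj)
  define l where "l a = fst (f a)" for a
  define c where "c a = fst (snd (f a))" for a
  define r where "r a = snd (snd (f a))" for a
  have f_eq: "f a = (l a, c a, r a)" for a
    by (simp add: l_def c_def r_def)
  have f_Arr: "l a \<in> Arr H" "c a \<in> Arr G" "r a \<in> Arr H"
    "Dom H (l a) = Dom H (\<phi> (c a))" "Dom H (r a) = Rng H (\<phi> (c a))" if "a \<in> Arr A" for a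
    using f.map_closed[OF that] unfolding f_eq by simp_all
  have f_Dom: "l (Dom A a) = l a" "c (Dom A a) = Dom G (c a)" "r (Dom A a) = l a"
    if "a \<in> Arr A" for a
    using f.map_Dom[OF that] unfolding f_eq cocyl_simps by simp_all
  have f_Rng: "l (Rng A a) = r a" "c (Rng A a) = Rng G (c a)" "r (Rng A a) = r a"
    if "a \<in> Arr A" for a
    using f.map_Rng[OF that] unfolding f_eq cocyl_simps by simp_all
  have f_Comp: "l (a \<cdot>\<^bsub>A\<^esub> b) = l a" "c (a \<cdot>\<^bsub>A\<^esub> b) = c a \<cdot>\<^bsub>G\<^esub> c b" "r (a \<cdot>\<^bsub>A\<^esub> b) = r b"
    if "a \<in> Arr A" "b \<in> Arr A" "Rng A a = Dom A b" for a b
    using f.map_Comp[OF that] unfolding f_eq cocyl_simps by simp_all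
  have f_Le: "l a \<preceq>\<^bsub>H\<^esub> l b" "c a \<preceq>\<^bsub>G\<^esub> c b" "r a \<preceq>\<^bsub>H\<^esub> r b"
    if "a \<preceq>\<^bsub>A\<^esub> b" "a \<in> Arr A" "b \<in> Arr A" for a b
    using f.map_Le[OF that] unfolding f_eq cocyl_simps by simp_all
  have F_zero: "F (a, I0) = (Inv H (l a) \<cdot>\<^bsub>H\<^esub> \<phi> (c a)) \<cdot>\<^bsub>H\<^esub> r a" if "a \<in> Arr A" for a
    using that pf unfolding f_eq proj_eq by simp
  define u where "u e i = F (e, outgoing i)" for e i
  have u_Arr: "u e i \<in> Arr H" "Dom H (u e i) = F (e, I0)" if "e \<in> Ids A" for e i
    using that F.map_Dom[of "(e, outgoing i)"] by (cases i; simp add: u_def)+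
  have u_Dom: "u (Dom A a) i \<in> Arr H" "Dom H (u (Dom A a) i) = Rng H (l a)"
    and u_Rng: "u (Rng A a) i \<in> Arr H" "Dom H (u (Rng A a) i) = Rng H (r a)"
    if "a \<in> Arr A" for a i
    using that u_Arr f_Arr F_zero F.map_Dom[of "(a, I0)"] F.map_Rng[of "(a, I0)"] by simp_all
  have u_zero: "u e I0 \<in> Ids H" if "e \<in> Ids A" for e
    using that F.map_Dom[of "(e, I0)"] F.map_closed[of "(e, I0)"] by (intro H.IdsI) (simp_all add: u_def)
  have u_Le: "u d i \<preceq>\<^bsub>H\<^esub> u e i" if "d \<preceq>\<^bsub>A\<^esub> e" "d \<in> Arr A" "e \<in> Arr A" for d e i
    using that by (simp add: u_def F.map_Le)
  define F' where "F' = (\<lambda>(a, i). (l a \<cdot>\<^bsub>H\<^esub> u (Dom A a) (interval_dom i), c a,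
      r a \<cdot>\<^bsub>H\<^esub> u (Rng A a) (interval_rng i)))"
  have F'_eq: "F' (a, i) = (l a \<cdot>\<^bsub>H\<^esub> u (Dom A a) (interval_dom i), c a,
      r a \<cdot>\<^bsub>H\<^esub> u (Rng A a) (interval_rng i))" for a i
    by (simp add: F'_def)
  have "ordered_functor ?P M F'"
  proof (intro ordered_functor.intro F.G.ordered_groupoid_axioms ordered_groupoid_cocyl
      ordered_functor_axioms.intro, goal_cases)
    case (1 x)
    then show ?case by (cases x) (simp add: F'_eq f_Arr u_Dom u_Rng)
  next
    case (2 x)
    then show ?case by (cases x; cases "snd x") (simp_all add: F'_eq f_Dom)
  next
    case (3 x)
    then show ?case by (cases x; cases "snd x") (simp_all add: F'_eq f_Rng)
  next
    case (4 x y)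
    then show ?case
      by (cases x; cases y; cases "snd x"; cases "snd y") (simp_all add: F'_eq f_Comp)
  next
    case 5
    show ?case
      by (auto simp: monotone_on_def F'_eq f_Arr f_Le u_Dom u_Rng u_Le A.Dom_mono A.Rng_mono
          intro!: H.OG2)
  qed
  moreover have "F' (a, I0) = f a" if "a \<in> Arr A" for a
  proof -
    have "u (Dom A a) I0 = Rng H (l a)"
      using that u_Dom(2)[of a I0] H.Dom_Id[OF u_zero, of "Dom A a"] by simp
    moreover have "u (Rng A a) I0 = Rng H (r a)"
      using that u_Rng(2)[of a I0] H.Dom_Id[OF u_zero, of "Rng A a"] by simp
    ultimately show ?thesis
      using that f_Arr by (simp add: F'_eq f_eq)
  qed
  moreover have "proj (F' (a, i)) = F (a, i)" if a: "a \<in> Arr A" for a i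
  proof -
    let ?d = "u (Dom A a) (interval_dom i)" and ?r = "u (Rng A a) (interval_rng i)"
    have "?d \<cdot>\<^bsub>H\<^esub> F (a, i) = F (Dom A a \<cdot>\<^bsub>A\<^esub> a, interval_comp (outgoing (interval_dom i)) i)"
      using a F.map_Comp[of "(Dom A a, outgoing (interval_dom i))" "(a, i)"]
      by (cases i) (simp_all add: u_def)
    also have "\<dots> = F (a \<cdot>\<^bsub>A\<^esub> Rng A a, interval_comp I0 (outgoing (interval_rng i)))"
      using a by (cases i) simp_all
    also have "\<dots> = F (a, I0) \<cdot>\<^bsub>H\<^esub> ?r"
      using a F.map_Comp[of "(a, I0)" "(Rng A a, outgoing (interval_rng i))"]
      by (cases i) (simp_all add: u_def)
    finally have square: "?d \<cdot>\<^bsub>H\<^esub> F (a, i) = F (a, I0) \<cdot>\<^bsub>H\<^esub> ?r" .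
    have "Rng H ?d = Dom H (F (a, i))"
      using a F.map_Rng[of "(Dom A a, outgoing (interval_dom i))"] F.map_Dom[of "(a, i)"]
      by (cases i) (simp_all add: u_def)
    then have "F (a, i) = Inv H ?d \<cdot>\<^bsub>H\<^esub> (?d \<cdot>\<^bsub>H\<^esub> F (a, i))"
      using a u_Dom by simp
    also have "\<dots> = proj (F' (a, i))"
      using a f_Arr u_Dom u_Rng by (simp add: square F_zero F'_eq proj_eq H.Comp_assoc)
    finally show ?thesis ..
  qed
  ultimately show "\<exists>F'. ordered_functor ?P M F' \<and> (\<forall>a \<in> Arr A. F' (a, I0) = f a) \<and>
      (\<forall>x \<in> Arr ?P. proj (F' x) = F x)"
    by (intro exI[of _ F']) auto
qed

lemma incl_eq: "incl g = (\<phi> (Dom G g), g, \<phi> (Rng G g))"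
  by (simp add: cocyl_in_def)

lemma ordered_embedding_incl: "ordered_embedding G M incl"
  unfolding ordered_embedding_def
proof (intro conjI ballI impI)
  show "ordered_functor G M incl"
    by (intro ordered_functor.intro G.ordered_groupoid_axioms ordered_groupoid_cocyl
        ordered_functor_axioms.intro)
      (auto simp: incl_eq monotone_on_def map_Le H.Dom_mono H.Rng_mono)
qed (simp_all add: incl_eq inj_on_def)

lemma in_image_incl: "(h0, a, h1) \<in> incl ` Arr G \<longleftrightarrow> a \<in> Arr G \<and> h0 = \<phi> (Dom G a) \<and> h1 = \<phi> (Rng G a)"
  by (auto simp: incl_eq)

text \<open>The order ideal condition uses that an arrow of \<open>H\<close> below an identity is an identity. Density
  is witnessed by \<open>\<langle>h, e, \<phi> e\<rangle>\<close>, which runs from \<open>(e, h)\<close> to the image of \<open>e\<close>.\<close>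

lemma enlargement_map_incl: "enlargement_map G M incl"
  unfolding enlargement_map_def
proof (intro conjI ordered_embedding_incl ordered_groupoid.enlargementI[OF ordered_groupoid_cocyl])
  show "incl ` Arr G \<subseteq> Arr M"
    by (auto simp: incl_eq)
next
  fix m assume "m \<in> incl ` Arr G"
  then show "Dom M m \<in> incl ` Arr G" "Rng M m \<in> incl ` Arr G"
    by (cases m; simp add: in_image_incl)+
next
  fix m n assume "m \<preceq>\<^bsub>M\<^esub> n" "m \<in> Ids M" "n \<in> Ids M" "n \<in> incl ` Arr G"
  moreover obtain h e k where m: "m = (h, e, k)"
    by (cases m)
  moreover obtain h' e' k' where n: "n = (h', e', k')"
    by (cases n)
  ultimately have e: "e \<in> Ids G" "h \<in> Arr H" "k = h" "Dom H h = \<phi> e"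
    and le: "h \<preceq>\<^bsub>H\<^esub> \<phi> e'" and e': "e' \<in> Ids G"
    by (auto simp: cocyl_Ids in_image_incl)
  have "h \<in> Ids H"
    using H.Le_Id_imp_Id[OF le] e e' by simp
  then have "h = \<phi> e"
    using e(4) by simp
  then show "m \<in> incl ` Arr G"
    using e by (simp add: m in_image_incl del: map_Dom map_Rng)
next
  fix m assume "Dom M m \<in> incl ` Arr G" "Rng M m \<in> incl ` Arr G" "m \<in> Arr M"
  then show "m \<in> incl ` Arr G"
    by (cases m) (simp add: in_image_incl)
next
  fix m assume "m \<in> Ids M"
  then obtain h e where m: "m = (h, e, h)" "e \<in> Ids G" "h \<in> Arr H" "Dom H h = \<phi> e"
    by (cases m) (auto simp: cocyl_Ids)
  then have "(h, e, \<phi> e) \<in> Arr M" "Dom M (h, e, \<phi> e) = m" "Rng M (h, e, \<phi> e) \<in> incl ` Arr G"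
    by (simp_all add: in_image_incl flip: map_Dom map_Rng)
  then show "\<exists>g \<in> Arr M. Dom M g = m \<and> Rng M g \<in> incl ` Arr G"
    by blast
qed

lemma proj_incl: "g \<in> Arr G \<Longrightarrow> proj (incl g) = \<phi> g"
  by (simp add: incl_eq proj_eq)

end

theorem corollary5p3:
  fixes G :: "'a ogpd" and H :: "'b ogpd" and \<phi> :: "'a \<Rightarrow> 'b"
  assumes "ordered_functor G H \<phi>"
  shows "let M = cocylinder G H \<phi>;
             p = cocyl_proj H \<phi>;
             A = Ker M H p;
             Q = quot M A
         in enlargement_map G M (cocyl_in G \<phi>) \<and>
            strong_fibration TYPE('c) M Q (qclass M A) \<and>
            covering Q H (induced p) \<and>
            (\<forall>m \<in> Arr M. induced p (qclass M A m) = p m) \<and>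
            (\<forall>g \<in> Arr G. induced p (qclass M A (cocyl_in G \<phi> g)) = \<phi> g)"
proof -
  interpret ordered_functor G H \<phi> by fact
  interpret proj: ordered_functor M H proj by (rule ordered_functor_proj)
  have cov: "covering proj.Q H (induced proj)"
    by (rule proj.covering_induced) (rule proj_star_surj)
  have "strong_fibration TYPE('c) M proj.Q proj.cls"
    by (rule strong_fibration_of_covering_factor[OF strong_fibration_proj proj.ordered_functor_cls cov])
      simp
  moreover have "induced proj (proj.cls (incl g)) = \<phi> g" if "g \<in> Arr G" for g
  proof -
    have "incl g \<in> Arr M"
      using that by (simp add: incl_eq)
    then show ?thesis
      using that by (simp add: proj_incl)
  qed
  ultimately show ?thesis
    unfolding Let_def using cov enlargement_map_incl by simp
qed

end
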